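(* Let $N$ be a complex manifold of dimension $k$. Let $\Gamma:=\bigcup_{z\in N}\Gamma_z$ be a closed family of closed cones $\Gamma_z$ of $(1,0)$-vectors at $z$, such that $\Gamma_z\neq\{0\}$ for every $z\in N$. Assume moreover that $N$ admits a smooth exhaustion function $\rho$ such that for all $z\in N$ and all non-zero $\xi_z\in\Gamma_z$, $$\langle i\partial\overline\partial\rho(z),i\xi_z\wedge\bar\xi_z\rangle>0 .$$ Let $U$ be a relatively compact open set in $N$ and let $K=\partial U$. Then $U\subset\widehat K_\Gamma$. In particular, for every $x\in U$ there is a probability measure $\mu_x$ on $\partial U$ and a positive current $T_x$ of bidimension $(1,1)$, with compact support, such that $$i\partial\overline\partial T_x=\mu_x-\delta_x .$$
   Context: "Closed family" means that $\Gamma$ is a closed subset of the $(1,0)$-tangent bundle of $N$. Define $$\mathcal P_\Gamma:=\{u\in\mathcal C^2(N):\ \langle i\partial\overline\partial u(z), i\xi_z\wedge\bar\xi_z\rangle\ge 0\ \text{for every } z\in N \text{ and every } \xi_z\in\Gamma_z\},$$ and for a compact $K\subset N$, $$\widehat K_\Gamma:=\{z\in N:\ u(z)\le\sup_K u\ \text{for every } u\in\mathcal P_\Gamma\}.$$ $\delta_x$ is the Dirac mass at $x$. *)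

theory Defs
  imports "HOL-Probability.Probability" "HOL-Library.Complex_Order"
begin

text \<open>
  A complex manifold of dimension \<open>CARD('k)\<close> is a Hausdorff, second countable space (the type
  \<open>'m\<close>) together with an atlas \<open>A\<close> of charts with values in \<open>complex ^ 'k\<close>.  A chart is a pair
  \<open>(D, \<phi>)\<close> of a domain and a coordinate map; the values of \<open>\<phi>\<close> outside \<open>D\<close> are irrelevant.
  Connectedness is not required.
\<close>

type_synonym ('m, 'k) chart = "'m set \<times> ('m \<Rightarrow> complex ^ 'k)"

definition chart_inv :: "('m, 'k::finite) chart \<Rightarrow> complex ^ 'k \<Rightarrow> 'm" where
  "chart_inv c = inv_into (fst c) (snd c)"

definition chart_image :: "('m, 'k::finite) chart \<Rightarrow> (complex ^ 'k) set" where
  "chart_image c = snd c ` fst c"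

definition transition ::
    "('m, 'k::finite) chart \<Rightarrow> ('m, 'k) chart \<Rightarrow> complex ^ 'k \<Rightarrow> complex ^ 'k" where
  "transition c c' = snd c' \<circ> chart_inv c"

definition holomorphic_map_on ::
    "(complex ^ 'k::finite) set \<Rightarrow> (complex ^ 'k \<Rightarrow> complex ^ 'l::finite) \<Rightarrow> bool" where
  "holomorphic_map_on S f \<longleftrightarrow>
     (\<forall>p\<in>S. \<exists>f'. (f has_derivative f') (at p) \<and> (\<forall>a v. f' (a *s v) = a *s f' v))"

definition complex_atlas ::
    "('m::{t2_space, second_countable_topology}, 'k::finite) chart set \<Rightarrow> bool" where
  "complex_atlas A \<longleftrightarrow>
     (\<Union>c\<in>A. fst c) = UNIV \<and>
     (\<forall>c\<in>A. open (fst c) \<and> open (chart_image c) \<and>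
        homeomorphism (fst c) (chart_image c) (snd c) (chart_inv c)) \<and>
     (\<forall>c\<in>A. \<forall>c'\<in>A. holomorphic_map_on (snd c ` (fst c \<inter> fst c')) (transition c c'))"

definition charts_at :: "('m, 'k::finite) chart set \<Rightarrow> 'm \<Rightarrow> ('m, 'k) chart set" where
  "charts_at A z = {c \<in> A. z \<in> fst c}"


section \<open>Functions of class \<open>C\<^sup>n\<close>\<close>

text \<open>\<open>iter_deriv [v\<^sub>1, \<dots>, v\<^sub>r] f = D\<^bsub>v\<^sub>1\<^esub> \<dots> D\<^bsub>v\<^sub>r\<^esub> f\<close> (iterated directional derivatives).\<close>

fun iter_deriv ::
    "'a::real_normed_vector list \<Rightarrow> ('a \<Rightarrow> 'b::real_normed_vector) \<Rightarrow> 'a \<Rightarrow> 'b" where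
  "iter_deriv [] f = f"
| "iter_deriv (v # vs) f = (\<lambda>x. frechet_derivative (iter_deriv vs f) (at x) v)"

text \<open>Meant for open sets \<open>S\<close>.\<close>

definition Ck_on ::
    "nat \<Rightarrow> 'a::real_normed_vector set \<Rightarrow> ('a \<Rightarrow> 'b::real_normed_vector) \<Rightarrow> bool" where
  "Ck_on n S f \<longleftrightarrow>
     (\<forall>vs. length vs \<le> n \<longrightarrow> continuous_on S (iter_deriv vs f)) \<and>
     (\<forall>vs. length vs < n \<longrightarrow> (\<forall>x\<in>S. iter_deriv vs f differentiable (at x)))"

definition Ck_manifold ::
    "('m, 'k::finite) chart set \<Rightarrow> nat \<Rightarrow> ('m \<Rightarrow> 'b::real_normed_vector) \<Rightarrow> bool" where
  "Ck_manifold A n u \<longleftrightarrow> (\<forall>c\<in>A. Ck_on n (chart_image c) (u \<circ> chart_inv c))"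

definition smooth_manifold ::
    "('m, 'k::finite) chart set \<Rightarrow> ('m \<Rightarrow> 'b::real_normed_vector) \<Rightarrow> bool" where
  "smooth_manifold A u \<longleftrightarrow> (\<forall>n. Ck_manifold A n u)"

definition smooth_exhaustion ::
    "('m::topological_space, 'k::finite) chart set \<Rightarrow> ('m \<Rightarrow> real) \<Rightarrow> bool" where
  "smooth_exhaustion A \<rho> \<longleftrightarrow> smooth_manifold A \<rho> \<and> (\<forall>r. compact {z. \<rho> z \<le> r})"


section \<open>The \<open>(1,0)\<close>-tangent bundle\<close>

text \<open>
  A \<open>(1,0)\<close>-tangent vector \<open>\<Sum>\<^sub>j \<xi>\<^sub>j \<partial>/\<partial>z\<^sub>j\<close> at \<open>z\<close> is represented by the family of its component
  vectors in all the charts at \<open>z\<close>, related by the (complex linear) derivatives of the transition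
  maps.  Components for other charts are set to zero, so that vectors are equal iff
  they have the same components in one (equivalently every) chart at \<open>z\<close>.
\<close>

type_synonym ('m, 'k) tvec = "('m, 'k) chart \<Rightarrow> complex ^ 'k"

definition tangent10 :: "('m, 'k::finite) chart set \<Rightarrow> 'm \<Rightarrow> ('m, 'k) tvec set" where
  "tangent10 A z =
     {\<xi>. (\<forall>c\<in>charts_at A z. \<forall>c'\<in>charts_at A z.
            \<xi> c' = frechet_derivative (transition c c') (at (snd c z)) (\<xi> c)) \<and>
         (\<forall>c. c \<notin> charts_at A z \<longrightarrow> \<xi> c = 0)}"

definition tangent_bundle10 :: "('m, 'k::finite) chart set \<Rightarrow> ('m \<times> ('m, 'k) tvec) set" where
  "tangent_bundle10 A = (SIGMA z:UNIV. tangent10 A z)"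

text \<open>The tangent vector at \<open>z\<close> whose component vector in the chart \<open>c\<close> is \<open>v\<close>.\<close>

definition chart_vec ::
    "('m, 'k::finite) chart set \<Rightarrow> ('m, 'k) chart \<Rightarrow> 'm \<Rightarrow> complex ^ 'k \<Rightarrow> ('m, 'k) tvec" where
  "chart_vec A c z v = (\<lambda>c'. if c' \<in> charts_at A z
     then frechet_derivative (transition c c') (at (snd c z)) v else 0)"

text \<open>
  The bundle topology: the trivialisations \<open>(z, v) \<mapsto> (z, chart_vec A c z v)\<close> of the bundle over the
  (open) chart domains are homeomorphisms onto open sets.
\<close>

definition open_in_bundle ::
    "('m::topological_space, 'k::finite) chart set \<Rightarrow> ('m \<times> ('m, 'k) tvec) set \<Rightarrow> bool" where
  "open_in_bundle A W \<longleftrightarrow> W \<subseteq> tangent_bundle10 A \<and>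
     (\<forall>c\<in>A. open {(z, v). z \<in> fst c \<and> (z, chart_vec A c z v) \<in> W})"

definition bundle_topology ::
    "('m::topological_space, 'k::finite) chart set \<Rightarrow> ('m \<times> ('m, 'k) tvec) topology" where
  "bundle_topology A = topology (open_in_bundle A)"

lemma istopology_open_in_bundle: "istopology (open_in_bundle A)"
  unfolding istopology_def
proof (intro conjI allI impI)
  fix S T assume S: "open_in_bundle A S" and T: "open_in_bundle A T"
  show "open_in_bundle A (S \<inter> T)"
    unfolding open_in_bundle_def
  proof (intro conjI ballI)
    show "S \<inter> T \<subseteq> tangent_bundle10 A" using S by (auto simp: open_in_bundle_def)
    fix c assume c: "c \<in> A"
    have "{(z, v). z \<in> fst c \<and> (z, chart_vec A c z v) \<in> S \<inter> T} =
        {(z, v). z \<in> fst c \<and> (z, chart_vec A c z v) \<in> S} \<inter>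
        {(z, v). z \<in> fst c \<and> (z, chart_vec A c z v) \<in> T}" by auto
    then show "open {(z, v). z \<in> fst c \<and> (z, chart_vec A c z v) \<in> S \<inter> T}"
      using S T c by (auto simp: open_in_bundle_def intro!: open_Int)
  qed
next
  fix \<K> assume K: "\<forall>S\<in>\<K>. open_in_bundle A S"
  show "open_in_bundle A (\<Union>\<K>)"
    unfolding open_in_bundle_def
  proof (intro conjI ballI)
    show "\<Union>\<K> \<subseteq> tangent_bundle10 A" using K by (auto simp: open_in_bundle_def)
    fix c assume c: "c \<in> A"
    have "{(z, v). z \<in> fst c \<and> (z, chart_vec A c z v) \<in> \<Union>\<K>} =
        (\<Union>S\<in>\<K>. {(z, v). z \<in> fst c \<and> (z, chart_vec A c z v) \<in> S})" by auto
    then show "open {(z, v). z \<in> fst c \<and> (z, chart_vec A c z v) \<in> \<Union>\<K>}"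
      using K c by (auto simp: open_in_bundle_def intro!: open_UN)
  qed
qed

lemma openin_bundle_topology: "openin (bundle_topology A) W \<longleftrightarrow> open_in_bundle A W"
  by (simp add: bundle_topology_def topology_inverse' istopology_open_in_bundle)

text \<open>
  Cones are only assumed to be stable under multiplication by nonnegative reals; this covers
  cones stable under multiplication by complex scalars.
\<close>

definition closed_cone_at ::
    "('m, 'k::finite) chart set \<Rightarrow> 'm \<Rightarrow> ('m, 'k) tvec set \<Rightarrow> bool" where
  "closed_cone_at A z C \<longleftrightarrow> C \<noteq> {} \<and> C \<subseteq> tangent10 A z \<and>
     (\<forall>\<xi>\<in>C. \<forall>t::real. t \<ge> 0 \<longrightarrow> (\<lambda>c. t *\<^sub>R \<xi> c) \<in> C) \<and>
     (\<forall>c\<in>charts_at A z. closed ((\<lambda>\<xi>. \<xi> c) ` C))"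

definition closed_family ::
    "('m::topological_space, 'k::finite) chart set \<Rightarrow> ('m \<Rightarrow> ('m, 'k) tvec set) \<Rightarrow> bool" where
  "closed_family A \<Gamma> \<longleftrightarrow> closedin (bundle_topology A) (SIGMA z:UNIV. \<Gamma> z)"


section \<open>Forms of bidegree \<open>(1,1)\<close>\<close>

text \<open>
  A \<open>(1,1)\<close>-form \<open>\<omega>\<close> is represented by the matrices \<open>h\<close> of its coefficients in all charts:
  \<open>\<omega> = i \<Sum>\<^sub>j\<^sub>l h\<^sub>j\<^sub>l dz\<^sub>j \<and> cnj dz\<^sub>l\<close>.  Note the factor \<open>i\<close>.  As for vectors, components that have no
  meaning are set to zero.
\<close>

type_synonym ('m, 'k) form11 = "('m, 'k) chart \<Rightarrow> 'm \<Rightarrow> complex ^ 'k ^ 'k"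

definition sesq :: "complex ^ 'k ^ 'k \<Rightarrow> complex ^ 'k \<Rightarrow> complex ^ 'k::finite \<Rightarrow> complex" where
  "sesq h v w = (\<Sum>j\<in>UNIV. \<Sum>l\<in>UNIV. h $ j $ l * v $ j * cnj (w $ l))"

text \<open>The change of chart formula, in terms of the evaluation on \<open>\<xi>\<close> and \<open>cnj \<eta>\<close>.\<close>

definition is_form11 :: "('m, 'k::finite) chart set \<Rightarrow> ('m, 'k) form11 \<Rightarrow> bool" where
  "is_form11 A \<omega> \<longleftrightarrow>
     (\<forall>z. \<forall>c\<in>charts_at A z. \<forall>c'\<in>charts_at A z. \<forall>\<xi>\<in>tangent10 A z. \<forall>\<eta>\<in>tangent10 A z.
        sesq (\<omega> c z) (\<xi> c) (\<eta> c) = sesq (\<omega> c' z) (\<xi> c') (\<eta> c')) \<and>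
     (\<forall>z c. c \<notin> charts_at A z \<longrightarrow> \<omega> c z = 0)"

text \<open>
  The pairing of \<open>\<omega>\<close> with \<open>i \<xi> \<and> cnj \<xi>\<close>, computed in the chart \<open>c\<close> at \<open>z\<close>, with the sign convention
  that \<open>i \<alpha> \<and> cnj \<alpha>\<close> is paired to \<open>\<bar>\<alpha>(\<xi>)\<bar>\<^sup>2 \<ge> 0\<close>; for \<open>\<omega> = i\<partial>\<partial>\<close>-bar \<open>u\<close> it is the Levi form of \<open>u\<close>.
\<close>

definition pair11 ::
    "('m, 'k::finite) form11 \<Rightarrow> ('m, 'k) chart \<Rightarrow> 'm \<Rightarrow> ('m, 'k) tvec \<Rightarrow> complex" where
  "pair11 \<omega> c z \<xi> = sesq (\<omega> c z) (\<xi> c) (\<xi> c)"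

text \<open>
  Here and below, \<open>0 \<le> w\<close> and \<open>0 < w\<close> for a complex number \<open>w\<close> include that \<open>w\<close> is real
  (theory \<^theory>\<open>HOL-Library.Complex_Order\<close>).
\<close>

definition positive_form11 :: "('m, 'k::finite) chart set \<Rightarrow> ('m, 'k) form11 \<Rightarrow> bool" where
  "positive_form11 A \<omega> \<longleftrightarrow>
     (\<forall>z. \<forall>\<xi>\<in>tangent10 A z. \<forall>c\<in>charts_at A z. 0 \<le> pair11 \<omega> c z \<xi>)"

text \<open>The Wirtinger derivatives \<open>\<partial>/\<partial>z\<^sub>j\<close> and \<open>\<partial>/\<partial>(cnj z\<^sub>j)\<close>.\<close>

definition wirtinger :: "'k \<Rightarrow> (complex ^ 'k::finite \<Rightarrow> complex) \<Rightarrow> complex ^ 'k \<Rightarrow> complex" where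
  "wirtinger j f p = (frechet_derivative f (at p) (axis j 1)
     - \<i> * frechet_derivative f (at p) (axis j \<i>)) / 2"

definition wirtinger_bar :: "'k \<Rightarrow> (complex ^ 'k::finite \<Rightarrow> complex) \<Rightarrow> complex ^ 'k \<Rightarrow> complex" where
  "wirtinger_bar j f p = (frechet_derivative f (at p) (axis j 1)
     + \<i> * frechet_derivative f (at p) (axis j \<i>)) / 2"

text \<open>The \<open>(1,1)\<close>-form \<open>i\<partial>\<partial>\<close>-bar \<open>u\<close> of a complex-valued function \<open>u\<close>.\<close>

definition i_ddbar :: "('m, 'k::finite) chart set \<Rightarrow> ('m \<Rightarrow> complex) \<Rightarrow> ('m, 'k) form11" where
  "i_ddbar A u = (\<lambda>c z. if c \<in> charts_at A z
     then (\<chi> j l. wirtinger j (wirtinger_bar l (u \<circ> chart_inv c)) (snd c z)) else 0)"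


section \<open>The class \<open>P\<^sub>\<Gamma>\<close> and hulls\<close>

definition P_class ::
    "('m, 'k::finite) chart set \<Rightarrow> ('m \<Rightarrow> ('m, 'k) tvec set) \<Rightarrow> ('m \<Rightarrow> real) set" where
  "P_class A \<Gamma> = {u. Ck_manifold A 2 u \<and>
     (\<forall>z. \<forall>\<xi>\<in>\<Gamma> z. \<forall>c\<in>charts_at A z.
        0 \<le> pair11 (i_ddbar A (\<lambda>y. complex_of_real (u y))) c z \<xi>)}"

text \<open>The supremum is taken in the extended reals, so that it is \<open>-\<infinity>\<close> for empty \<open>K\<close>.\<close>

definition Gamma_hull ::
    "('m, 'k::finite) chart set \<Rightarrow> ('m \<Rightarrow> ('m, 'k) tvec set) \<Rightarrow> 'm set \<Rightarrow> 'm set" where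
  "Gamma_hull A \<Gamma> K = {z. \<forall>u\<in>P_class A \<Gamma>. ereal (u z) \<le> (SUP y\<in>K. ereal (u y))}"


section \<open>Currents of bidimension \<open>(1,1)\<close>\<close>

definition test_functions ::
    "('m::topological_space, 'k::finite) chart set \<Rightarrow> ('m \<Rightarrow> complex) set" where
  "test_functions A = {\<phi>. smooth_manifold A \<phi> \<and> compact (closure {z. \<phi> z \<noteq> 0})}"

definition form_support :: "('m::topological_space, 'k::finite) form11 \<Rightarrow> 'm set" where
  "form_support \<omega> = closure {z. \<exists>c. \<omega> c z \<noteq> 0}"

definition form_coeff ::
    "('m, 'k::finite) form11 \<Rightarrow> ('m, 'k) chart \<Rightarrow> 'k \<Rightarrow> 'k \<Rightarrow> complex ^ 'k \<Rightarrow> complex" where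
  "form_coeff \<omega> c j l = (\<lambda>p. \<omega> c (chart_inv c p) $ j $ l)"

definition test_forms11 ::
    "('m::topological_space, 'k::finite) chart set \<Rightarrow> ('m, 'k) form11 set" where
  "test_forms11 A = {\<omega>. is_form11 A \<omega> \<and>
     (\<forall>c\<in>A. \<forall>j l n. Ck_on n (chart_image c) (form_coeff \<omega> c j l)) \<and>
     compact (form_support \<omega>)}"

text \<open>Convergence to \<open>0\<close> of a sequence in the space of test forms.\<close>

definition test_forms_tendsto_0 ::
    "('m::topological_space, 'k::finite) chart set \<Rightarrow> (nat \<Rightarrow> ('m, 'k) form11) \<Rightarrow> bool" where
  "test_forms_tendsto_0 A W \<longleftrightarrow>
     (\<exists>L. compact L \<and> (\<forall>n. form_support (W n) \<subseteq> L)) \<and>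
     (\<forall>c\<in>A. \<forall>B. compact B \<and> B \<subseteq> chart_image c \<longrightarrow>
        (\<forall>vs j l. uniform_limit B (\<lambda>n. iter_deriv vs (form_coeff (W n) c j l)) (\<lambda>_. 0)
           sequentially))"

text \<open>The values of \<open>T\<close> outside \<open>test_forms11 A\<close> are irrelevant.\<close>

definition current11 ::
    "('m::topological_space, 'k::finite) chart set \<Rightarrow> (('m, 'k) form11 \<Rightarrow> complex) \<Rightarrow> bool" where
  "current11 A T \<longleftrightarrow>
     (\<forall>\<omega>\<in>test_forms11 A. \<forall>\<omega>'\<in>test_forms11 A. T (\<lambda>c z. \<omega> c z + \<omega>' c z) = T \<omega> + T \<omega>') \<and>
     (\<forall>\<omega>\<in>test_forms11 A. \<forall>a. T (\<lambda>c z. \<chi> j l. a * \<omega> c z $ j $ l) = a * T \<omega>) \<and>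
     (\<forall>W. (\<forall>n. W n \<in> test_forms11 A) \<and> test_forms_tendsto_0 A W \<longrightarrow> (\<lambda>n. T (W n)) \<longlonglongrightarrow> 0)"

definition positive_current11 ::
    "('m::topological_space, 'k::finite) chart set \<Rightarrow> (('m, 'k) form11 \<Rightarrow> complex) \<Rightarrow> bool" where
  "positive_current11 A T \<longleftrightarrow> current11 A T \<and>
     (\<forall>\<omega>\<in>test_forms11 A. positive_form11 A \<omega> \<longrightarrow> 0 \<le> T \<omega>)"

definition current_support ::
    "('m::topological_space, 'k::finite) chart set \<Rightarrow> (('m, 'k) form11 \<Rightarrow> complex) \<Rightarrow> 'm set" where
  "current_support A T =
     - \<Union>{V. open V \<and> (\<forall>\<omega>\<in>test_forms11 A. form_support \<omega> \<subseteq> V \<longrightarrow> T \<omega> = 0)}"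

text \<open>
  The current \<open>i\<partial>\<partial>\<close>-bar \<open>T\<close> of bidimension \<open>(0,0)\<close>, defined by duality.  The operator is of even
  order, so there is no sign.
\<close>

definition i_ddbar_current ::
    "('m, 'k::finite) chart set \<Rightarrow> (('m, 'k) form11 \<Rightarrow> complex) \<Rightarrow> ('m \<Rightarrow> complex) \<Rightarrow> complex" where
  "i_ddbar_current A T = (\<lambda>\<phi>. T (i_ddbar A \<phi>))"

end

theory Submission
  imports Defs
begin

text \<open>
  If \<open>u\<close> violated the hull inequality, then \<open>u + \<epsilon> \<rho>\<close> would for small \<open>\<epsilon>\<close> have a maximum inside \<open>U\<close>, where
  its Levi form would be positive in some direction.

  For the current, choose at each point of \<open>U\<close> a direction \<open>v\<close> in which the Levi form of \<open>\<rho>\<close> is bounded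
  below.  By the same maximum principle, \<open>\<phi> x\<close> is a positive linear functional of the
  data consisting of \<open>\<phi>\<close> on the boundary and \<open>- \<langle>i\<partial>\<partial>\<close>-bar \<open>\<phi>, i v \<and> cnj v\<rangle>\<close> on \<open>U\<close>, and \<open>C - M \<rho>\<close> gives data
  bounded below by 1.  A positive extension to all bounded functions on the closure of \<open>U\<close> splits into
  a boundary part, represented by \<open>\<mu>\<close>, and an interior part, which is the current.
\<close>

section \<open>Calculus of iterated derivatives\<close>

text \<open>The chosen directions depend on the point with no continuity or measurability, so the
  data attached to \<open>\<phi>\<close> is in general a discontinuous function on the closure of
  \<open>U\<close>. This is why the functional is extended to all bounded functions, and why it is
  only finitely additive. Inside \<open>U\<close> that is enough: a positive functional is bounded
  in the sup norm, and this gives continuity on sequences of test forms whose coefficients tend to 0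
  uniformly on compact sets. Only the boundary part has to become a countably additive measure, and
  there the data is the restriction of \<open>\<phi>\<close> itself, which is continuous.

  The data bounded below by 1 is an order unit: every bounded function lies below a multiple of it,
  which keeps the extension finite. To have such data, the Levi form of \<open>\<rho>\<close> needs
  a uniform lower bound \<open>\<delta>\<close> along the directions; \<open>M\<close> is then
  \<open>1 / \<delta>\<close> and \<open>C\<close> only has to beat \<open>\<rho>\<close> on the
  closure of \<open>U\<close>. Constants have Levi form 0, so evaluating the functional on the data
  of 1 shows that the boundary part has mass 1.\<close>

lemma frechet_derivative_cong_open:
  assumes "open S" "x \<in> S" "\<And>y. y \<in> S \<Longrightarrow> f y = g y"
  shows "frechet_derivative f (at x) = frechet_derivative g (at x)"
proof -
  have "(f has_derivative f') (at x) \<longleftrightarrow> (g has_derivative f') (at x)" for f'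
    using assms by (metis has_derivative_transform_within_open)
  then show ?thesis by (simp add: frechet_derivative_def)
qed

lemma differentiable_cong_open:
  assumes "open S" "x \<in> S" "\<And>y. y \<in> S \<Longrightarrow> f y = g y"
  shows "f differentiable (at x) \<longleftrightarrow> g differentiable (at x)"
proof -
  have "(f has_derivative f') (at x) \<longleftrightarrow> (g has_derivative f') (at x)" for f'
    using assms by (metis has_derivative_transform_within_open)
  then show ?thesis by (simp add: differentiable_def)
qed

lemma Ck_onD:
  assumes "Ck_on n S f"
  shows "length vs \<le> n \<Longrightarrow> continuous_on S (iter_deriv vs f)"
    and "length vs < n \<Longrightarrow> x \<in> S \<Longrightarrow> iter_deriv vs f differentiable (at x)"
  using assms by (auto simp: Ck_on_def)

lemma iter_deriv_bounded_linear:
  assumes "bounded_linear L" "open S" "Ck_on n S f" "length vs \<le> n" "x \<in> S"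
  shows "iter_deriv vs (\<lambda>y. L (f y)) x = L (iter_deriv vs f x)"
  using assms(4,5)
proof (induction vs arbitrary: x)
  case (Cons v vs)
  let ?g = "iter_deriv vs f"
  have "frechet_derivative (iter_deriv vs (\<lambda>y. L (f y))) (at x) =
        frechet_derivative (\<lambda>y. L (?g y)) (at x)"
    using Cons by (intro frechet_derivative_cong_open[OF assms(2)]) auto
  also have "\<dots> = (\<lambda>v. L (frechet_derivative ?g (at x) v))"
    using Ck_onD(2)[OF assms(3), of vs x] Cons.prems
    by (intro frechet_derivative_at[symmetric] bounded_linear.has_derivative[OF assms(1)])
       (auto simp: frechet_derivative_works)
  finally show ?case by simp
qed simp

lemma Ck_on_bounded_linear:
  fixes f :: "'a::real_normed_vector \<Rightarrow> 'b::real_normed_vector"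
    and L :: "'b \<Rightarrow> 'c::real_normed_vector"
  assumes "bounded_linear L" "open S" "Ck_on n S f"
  shows "Ck_on n S (\<lambda>y. L (f y))"
  unfolding Ck_on_def
proof (intro conjI allI impI ballI)
  fix vs :: "'a list" assume *: "length vs \<le> n"
  show "continuous_on S (iter_deriv vs (\<lambda>y. L (f y)))"
    using iter_deriv_bounded_linear[OF assms *]
      bounded_linear.continuous_on[OF assms(1) Ck_onD(1)[OF assms(3) *]]
    by (metis (no_types, lifting) continuous_on_cong)
next
  fix vs :: "'a list" and x assume *: "length vs < n" "x \<in> S"
  have "(\<lambda>y. L (iter_deriv vs f y)) differentiable (at x)"
    using bounded_linear.has_derivative[OF assms(1)] Ck_onD(2)[OF assms(3) *]
    unfolding differentiable_def by blast
  then show "iter_deriv vs (\<lambda>y. L (f y)) differentiable (at x)"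
    by (rule differentiable_cong_open[OF assms(2) *(2), THEN iffD1, rotated])
       (use iter_deriv_bounded_linear[OF assms, of vs] * in simp)
qed

lemma iter_deriv_add:
  assumes "open S" "Ck_on n S f" "Ck_on n S g" "length vs \<le> n" "x \<in> S"
  shows "iter_deriv vs (\<lambda>y. f y + g y) x = iter_deriv vs f x + iter_deriv vs g x"
  using assms(4,5)
proof (induction vs arbitrary: x)
  case (Cons v vs)
  have "frechet_derivative (iter_deriv vs (\<lambda>y. f y + g y)) (at x) =
        frechet_derivative (\<lambda>y. iter_deriv vs f y + iter_deriv vs g y) (at x)"
    using Cons by (intro frechet_derivative_cong_open[OF assms(1)]) auto
  also have "\<dots> = (\<lambda>v. frechet_derivative (iter_deriv vs f) (at x) v + frechet_derivative (iter_deriv vs g) (at x) v)"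
    using Ck_onD(2)[OF assms(2), of vs x] Ck_onD(2)[OF assms(3), of vs x] Cons.prems
    by (intro frechet_derivative_at[symmetric] has_derivative_add)
       (auto simp: frechet_derivative_works)
  finally show ?case by simp
qed simp

lemma Ck_on_add:
  assumes "open S" "Ck_on n S f" "Ck_on n S g"
  shows "Ck_on n S (\<lambda>y. f y + g y)"
  unfolding Ck_on_def
proof (intro conjI allI impI ballI)
  fix vs :: "'a list" assume *: "length vs \<le> n"
  show "continuous_on S (iter_deriv vs (\<lambda>y. f y + g y))"
    using iter_deriv_add[OF assms *]
      continuous_on_add[OF Ck_onD(1)[OF assms(2) *] Ck_onD(1)[OF assms(3) *]]
    by (metis (no_types, lifting) continuous_on_cong)
next
  fix vs :: "'a list" and x assume *: "length vs < n" "x \<in> S"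
  have "(\<lambda>y. iter_deriv vs f y + iter_deriv vs g y) differentiable (at x)"
    using Ck_onD(2)[OF assms(2) *] Ck_onD(2)[OF assms(3) *] by (rule differentiable_add)
  then show "iter_deriv vs (\<lambda>y. f y + g y) differentiable (at x)"
    by (rule differentiable_cong_open[OF assms(1) *(2), THEN iffD1, rotated])
       (use iter_deriv_add[OF assms, of vs] * in simp)
qed

lemma iter_deriv_const: "iter_deriv vs (\<lambda>_. a) = (\<lambda>_. if vs = [] then a else 0)"
  by (induction vs) simp_all

lemma Ck_on_const: "Ck_on n S (\<lambda>_. a)"
  by (auto simp: Ck_on_def iter_deriv_const)

lemma Ck_on_2_has_derivative:
  assumes "Ck_on 2 S f" "x \<in> S"
  shows "(f has_derivative (\<lambda>v. iter_deriv [v] f x)) (at x)"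
    and "(iter_deriv [w] f has_derivative (\<lambda>v. iter_deriv [v, w] f x)) (at x)"
  using Ck_onD(2)[OF assms(1), of "[]" x] Ck_onD(2)[OF assms(1), of "[w]" x] assms(2)
  by (simp_all add: frechet_derivative_works)

text \<open>Linearity in the outer direction is that of a derivative. For the inner direction, first
  derivatives are linear in the direction at every point of the open set \<open>S\<close>;
  differentiating that identity and using uniqueness of derivatives transfers it to second
  derivatives.\<close>

lemma bilinear_iter_deriv:
  assumes "open S" "Ck_on 2 S f" "x \<in> S"
  shows "bilinear (\<lambda>v w. iter_deriv [v, w] f x)"
  unfolding bilinear_def
proof (intro conjI allI)
  show "linear (\<lambda>v. iter_deriv [v, w] f x)" for w
    using Ck_on_2_has_derivative(2)[OF assms(2,3)] by (rule has_derivative_linear)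
  have lin: "linear (\<lambda>v. iter_deriv [v] f y)" if "y \<in> S" for y
    using Ck_on_2_has_derivative(1)[OF assms(2) that] by (rule has_derivative_linear)
  show "linear (\<lambda>w. iter_deriv [v, w] f x)" for v
  proof (rule linearI)
    fix a b and r :: real
    have "((\<lambda>y. iter_deriv [a] f y + iter_deriv [b] f y) has_derivative
        (\<lambda>v. iter_deriv [v, a] f x + iter_deriv [v, b] f x)) (at x)"
      by (intro has_derivative_add Ck_on_2_has_derivative(2)[OF assms(2,3)])
    then have "(iter_deriv [a + b] f has_derivative
        (\<lambda>v. iter_deriv [v, a] f x + iter_deriv [v, b] f x)) (at x)"
      by (rule has_derivative_transform_within_open[OF _ assms(1,3)])
         (use linear_add[OF lin] in auto)
    from has_derivative_unique[OF this Ck_on_2_has_derivative(2)[OF assms(2,3)]]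
    show "iter_deriv [v, a + b] f x = iter_deriv [v, a] f x + iter_deriv [v, b] f x"
      by metis
    have "((\<lambda>y. r *\<^sub>R iter_deriv [a] f y) has_derivative (\<lambda>v. r *\<^sub>R iter_deriv [v, a] f x)) (at x)"
      by (intro has_derivative_scaleR_right Ck_on_2_has_derivative(2)[OF assms(2,3)])
    then have "(iter_deriv [r *\<^sub>R a] f has_derivative (\<lambda>v. r *\<^sub>R iter_deriv [v, a] f x)) (at x)"
      by (rule has_derivative_transform_within_open[OF _ assms(1,3)])
         (use linear_cmul[OF lin] in auto)
    from has_derivative_unique[OF this Ck_on_2_has_derivative(2)[OF assms(2,3)]]
    show "iter_deriv [v, r *\<^sub>R a] f x = r *\<^sub>R iter_deriv [v, a] f x"
      by metis
  qed
qed

declare iter_deriv.simps(2) [simp del]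

lemma Ck_on_2_deriv_line:
  fixes f :: "'a::real_normed_vector \<Rightarrow> real"
  assumes "Ck_on 2 S f" "x + t *\<^sub>R v \<in> S"
  shows "((\<lambda>t. f (x + t *\<^sub>R v)) has_real_derivative iter_deriv [v] f (x + t *\<^sub>R v)) (at t)"
    and "((\<lambda>t. iter_deriv [w] f (x + t *\<^sub>R v)) has_real_derivative iter_deriv [v, w] f (x + t *\<^sub>R v)) (at t)"
proof -
  have *: "((\<lambda>t. g (x + t *\<^sub>R v)) has_real_derivative g' v) (at t)"
    if g: "(g has_derivative g') (at (x + t *\<^sub>R v))" for g :: "'a \<Rightarrow> real" and g'
  proof -
    have "((\<lambda>t. x + t *\<^sub>R v) has_derivative (\<lambda>t. t *\<^sub>R v)) (at t)"
      by (auto intro!: derivative_eq_intros)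
    from diff_chain_at[OF this g] show ?thesis
      using linear_cmul[OF has_derivative_linear[OF g]]
      by (simp add: has_field_derivative_def o_def mult.commute[of _ "g' v"] cong: if_cong)
  qed
  show "((\<lambda>t. f (x + t *\<^sub>R v)) has_real_derivative iter_deriv [v] f (x + t *\<^sub>R v)) (at t)"
    by (rule * Ck_on_2_has_derivative[OF assms])+
  show "((\<lambda>t. iter_deriv [w] f (x + t *\<^sub>R v)) has_real_derivative iter_deriv [v, w] f (x + t *\<^sub>R v)) (at t)"
    by (rule * Ck_on_2_has_derivative[OF assms])+
qed

section \<open>Symmetry of second derivatives and the second derivative test\<close>

text \<open>The mean value theorem is applied twice: to
  \<open>f (x + t w + r v) - f (x + r v)\<close> as a function of \<open>r\<close>, then to the
  derivative along \<open>v\<close> as a function of the coefficient \<open>s\<close> of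
  \<open>w\<close>. The second difference is symmetric in \<open>v\<close> and \<open>w\<close>, the
  right hand side is not; comparing the two orders gives Schwarz's theorem.\<close>

lemma second_difference:
  fixes f :: "'a::real_normed_vector \<Rightarrow> real"
  assumes f: "Ck_on 2 S f" and "t > 0"
    and S: "\<And>r s. 0 \<le> r \<Longrightarrow> r \<le> t \<Longrightarrow> 0 \<le> s \<Longrightarrow> s \<le> t \<Longrightarrow> x + r *\<^sub>R v + s *\<^sub>R w \<in> S"
  obtains r s where "0 < r" "r < t" "0 < s" "s < t"
    "f (x + t *\<^sub>R v + t *\<^sub>R w) - f (x + t *\<^sub>R v) - f (x + t *\<^sub>R w) + f x
       = t * t * iter_deriv [w, v] f (x + r *\<^sub>R v + s *\<^sub>R w)"
proof -
  have S0: "x + r *\<^sub>R v \<in> S" if "0 \<le> r" "r \<le> t" for r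
    using S[OF that, of 0] \<open>t > 0\<close> by simp
  have St: "(x + t *\<^sub>R w) + r *\<^sub>R v \<in> S" if "0 \<le> r" "r \<le> t" for r
    using S[OF that, of t] \<open>t > 0\<close> by (simp add: algebra_simps)
  have "\<exists>r. 0 < r \<and> r < t \<and>
      (f ((x + t *\<^sub>R w) + t *\<^sub>R v) - f (x + t *\<^sub>R v)) - (f ((x + t *\<^sub>R w) + 0 *\<^sub>R v) - f (x + 0 *\<^sub>R v))
        = (t - 0) * (iter_deriv [v] f ((x + t *\<^sub>R w) + r *\<^sub>R v) - iter_deriv [v] f (x + r *\<^sub>R v))"
    by (rule MVT2[OF \<open>t > 0\<close>])
       (intro DERIV_diff Ck_on_2_deriv_line(1)[OF f] S0 St; simp)
  then obtain r where r: "0 < r" "r < t"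
      "(f ((x + t *\<^sub>R w) + t *\<^sub>R v) - f (x + t *\<^sub>R v)) - (f ((x + t *\<^sub>R w)) - f x)
        = t * (iter_deriv [v] f ((x + t *\<^sub>R w) + r *\<^sub>R v) - iter_deriv [v] f (x + r *\<^sub>R v))"
    by auto
  have "\<exists>s. 0 < s \<and> s < t \<and>
      iter_deriv [v] f ((x + r *\<^sub>R v) + t *\<^sub>R w) - iter_deriv [v] f ((x + r *\<^sub>R v) + 0 *\<^sub>R w)
        = (t - 0) * iter_deriv [w, v] f ((x + r *\<^sub>R v) + s *\<^sub>R w)"
    using r by (intro MVT2[OF \<open>t > 0\<close>] Ck_on_2_deriv_line(2)[OF f] S) auto
  then obtain s where s: "0 < s" "s < t"
      "iter_deriv [v] f ((x + r *\<^sub>R v) + t *\<^sub>R w) - iter_deriv [v] f (x + r *\<^sub>R v)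
        = t * iter_deriv [w, v] f ((x + r *\<^sub>R v) + s *\<^sub>R w)"
    by auto
  show ?thesis
  proof (rule that[OF r(1,2) s(1,2)])
    have eqs: "(x + t *\<^sub>R w) + r *\<^sub>R v = (x + r *\<^sub>R v) + t *\<^sub>R w"
      "(x + t *\<^sub>R w) + t *\<^sub>R v = x + t *\<^sub>R v + t *\<^sub>R w" by (simp_all add: algebra_simps)
    then have "f (x + t *\<^sub>R v + t *\<^sub>R w) - f (x + t *\<^sub>R v) - f (x + t *\<^sub>R w) + f x =
        t * (iter_deriv [v] f ((x + r *\<^sub>R v) + t *\<^sub>R w) - iter_deriv [v] f (x + r *\<^sub>R v))"
      using r(3) unfolding eqs by linarith
    then show "f (x + t *\<^sub>R v + t *\<^sub>R w) - f (x + t *\<^sub>R v) - f (x + t *\<^sub>R w) + f x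
       = t * t * iter_deriv [w, v] f (x + r *\<^sub>R v + s *\<^sub>R w)"
      unfolding s(3) by simp
  qed
qed

lemma iter_deriv_commute:
  fixes f :: "'a::real_normed_vector \<Rightarrow> real"
  assumes "open S" and f: "Ck_on 2 S f" and "x \<in> S"
  shows "iter_deriv [v, w] f x = iter_deriv [w, v] f x"
proof (rule ccontr)
  assume neq: "iter_deriv [v, w] f x \<noteq> iter_deriv [w, v] f x"
  \<comment> \<open>Half the supposed gap: two values within \<open>e\<close> of the two mixed
    derivatives cannot coincide.\<close>
  define e where "e = \<bar>iter_deriv [v, w] f x - iter_deriv [w, v] f x\<bar> / 2"
  have "e > 0" using neq by (simp add: e_def)
  have cont: "isCont (iter_deriv [a, b] f) x" for a b
    using Ck_onD(1)[OF f, of "[a, b]"] assms(1,3) by (simp add: continuous_on_eq_continuous_at)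
  have "\<forall>\<^sub>F y in nhds x. dist (iter_deriv [a, b] f y) (iter_deriv [a, b] f x) < e" for a b
    using cont[of a b] \<open>e > 0\<close> unfolding isCont_def tendsto_at_iff_tendsto_nhds
    by (rule tendstoD)
  then have "\<forall>\<^sub>F y in nhds x. y \<in> S \<and> dist (iter_deriv [v, w] f y) (iter_deriv [v, w] f x) < e
      \<and> dist (iter_deriv [w, v] f y) (iter_deriv [w, v] f x) < e"
    using assms(1,3) by (intro eventually_conj eventually_nhds_in_open) auto
  then obtain d where d: "d > 0" "\<And>y. dist y x < d \<Longrightarrow> y \<in> S \<and>
      dist (iter_deriv [v, w] f y) (iter_deriv [v, w] f x) < e \<and> dist (iter_deriv [w, v] f y) (iter_deriv [w, v] f x) < e"
    unfolding eventually_nhds_metric by blast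
  \<comment> \<open>The parallelogram at \<open>x\<close> spanned by \<open>t v\<close> and
    \<open>t w\<close> then lies in the \<open>d\<close>-ball; the summand 1 covers
    \<open>v = w = 0\<close>.\<close>
  define t where "t = d / (norm v + norm w + 1)"
  have pos: "norm v + norm w + 1 > 0" by (simp add: add_nonneg_pos)
  then have "t > 0" using d(1) by (simp add: t_def)
  have near: "dist (x + r *\<^sub>R a + s *\<^sub>R b) x < d"
    if "0 \<le> r" "r \<le> t" "0 \<le> s" "s \<le> t" "{a, b} = {v, w}" for r s a b
  proof -
    have "dist (x + r *\<^sub>R a + s *\<^sub>R b) x = norm (r *\<^sub>R a + s *\<^sub>R b)"
      by (simp add: dist_norm add.assoc)
    also have "\<dots> \<le> r * norm a + s * norm b"
      using that norm_triangle_ineq[of "r *\<^sub>R a" "s *\<^sub>R b"] by simp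
    also have "\<dots> \<le> t * norm a + t * norm b"
      using that by (intro add_mono mult_right_mono) auto
    also have "\<dots> = t * (norm v + norm w)"
      using that(5) by (auto simp: doubleton_eq_iff algebra_simps)
    also have "\<dots> < t * (norm v + norm w + 1)" using \<open>t > 0\<close> by simp
    also have "\<dots> = d" using pos by (simp add: t_def)
    finally show ?thesis .
  qed
  obtain r s where 1: "0 < r" "r < t" "0 < s" "s < t"
    "f (x + t *\<^sub>R v + t *\<^sub>R w) - f (x + t *\<^sub>R v) - f (x + t *\<^sub>R w) + f x
       = t * t * iter_deriv [w, v] f (x + r *\<^sub>R v + s *\<^sub>R w)"
    by (rule second_difference[OF f \<open>t > 0\<close>, of x v w])
      (use d(2) near[of _ _ v w] in blast)+
  obtain r' s' where 2: "0 < r'" "r' < t" "0 < s'" "s' < t"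
    "f (x + t *\<^sub>R w + t *\<^sub>R v) - f (x + t *\<^sub>R w) - f (x + t *\<^sub>R v) + f x
       = t * t * iter_deriv [v, w] f (x + r' *\<^sub>R w + s' *\<^sub>R v)"
    by (rule second_difference[OF f \<open>t > 0\<close>, of x w v])
      (use d(2) near[of _ _ w v] in blast)+
  have eq: "x + t *\<^sub>R w + t *\<^sub>R v = x + t *\<^sub>R v + t *\<^sub>R w" by (simp add: algebra_simps)
  have "t * t * iter_deriv [w, v] f (x + r *\<^sub>R v + s *\<^sub>R w)
      = t * t * iter_deriv [v, w] f (x + r' *\<^sub>R w + s' *\<^sub>R v)"
    using 1(5) 2(5)[unfolded eq] by linarith
  then have "iter_deriv [w, v] f (x + r *\<^sub>R v + s *\<^sub>R w) = iter_deriv [v, w] f (x + r' *\<^sub>R w + s' *\<^sub>R v)"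
    using \<open>t > 0\<close> by simp
  moreover have "dist (iter_deriv [w, v] f (x + r *\<^sub>R v + s *\<^sub>R w)) (iter_deriv [w, v] f x) < e"
    "dist (iter_deriv [v, w] f (x + r' *\<^sub>R w + s' *\<^sub>R v)) (iter_deriv [v, w] f x) < e"
    using d(2) near 1 2 by (simp_all add: insert_commute)
  ultimately have "dist (iter_deriv [v, w] f x) (iter_deriv [w, v] f x) < e + e"
    by (metis (no_types, opaque_lifting) add.commute dist_commute dist_triangle_less_add)
  then show False by (simp add: e_def dist_real_def)
qed

text \<open>Along the line through \<open>x\<close>, the first derivative \<open>g\<close> vanishes
  at 0. If \<open>g\<close> had negative slope there, it would be negative just to the right of 0,
  and by the mean value theorem \<open>f\<close> would drop below \<open>f x\<close>.\<close>

lemma local_min_iter_deriv_nonneg: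
  fixes f :: "'a::real_normed_vector \<Rightarrow> real"
  assumes "open S" and f: "Ck_on 2 S f" and "x \<in> S" and min: "\<And>y. y \<in> S \<Longrightarrow> f x \<le> f y"
  shows "iter_deriv [v, v] f x \<ge> 0"
proof (rule ccontr)
  assume neg: "\<not> iter_deriv [v, v] f x \<ge> 0"
  have "open ((\<lambda>t::real. x + t *\<^sub>R v) -` S)"
    by (intro open_vimage assms(1) continuous_intros)
  moreover have "0 \<in> (\<lambda>t::real. x + t *\<^sub>R v) -` S" using \<open>x \<in> S\<close> by simp
  ultimately obtain d where d: "d > 0" "ball 0 d \<subseteq> (\<lambda>t::real. x + t *\<^sub>R v) -` S"
    unfolding open_contains_ball by blast
  then have d: "d > 0" "\<And>t. \<bar>t\<bar> < d \<Longrightarrow> x + t *\<^sub>R v \<in> S"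
    by (auto simp: subset_eq)
  define g where "g t = iter_deriv [v] f (x + t *\<^sub>R v)" for t
  have f': "((\<lambda>t. f (x + t *\<^sub>R v)) has_real_derivative g t) (at t)" if "\<bar>t\<bar> < d" for t
    unfolding g_def by (rule Ck_on_2_deriv_line[OF f d(2)[OF that]])
  have g': "(g has_real_derivative iter_deriv [v, v] f x) (at 0)"
    using Ck_on_2_deriv_line(2)[OF f, of x 0 v v] \<open>x \<in> S\<close> unfolding g_def by simp
  have "g 0 = 0"
    by (rule DERIV_local_min[OF f' d(1)]) (use d min in auto)
  obtain e where e: "e > 0" "\<And>h. 0 < h \<Longrightarrow> h < e \<Longrightarrow> g h < 0"
    using DERIV_neg_dec_right[OF g'] neg \<open>g 0 = 0\<close> by auto
  define h where "h = min d e / 2"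
  have h: "0 < h" "h < d" "h < e" using d(1) e(1) by (auto simp: h_def)
  have "\<exists>z. 0 < z \<and> z < h \<and> f (x + h *\<^sub>R v) - f (x + 0 *\<^sub>R v) = (h - 0) * g z"
    by (rule MVT2[OF h(1)]) (use f' h in auto)
  then obtain z where z: "0 < z" "z < h" "f (x + h *\<^sub>R v) - f x = h * g z"
    by auto
  have "h * g z < 0" using e(2)[of z] z h by (simp add: mult_pos_neg)
  then show False using z(3) min[OF d(2)[of h]] h by simp
qed

section \<open>The Levi matrix in terms of real second derivatives\<close>

lemma wirtinger_wirtinger_bar:
  assumes S: "open S" "Ck_on 2 S f" "p \<in> S"
  shows "wirtinger j (wirtinger_bar l f) p =
    (iter_deriv [axis j 1, axis l 1] f p + iter_deriv [axis j \<i>, axis l \<i>] f p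
      + \<i> * (iter_deriv [axis j 1, axis l \<i>] f p - iter_deriv [axis j \<i>, axis l 1] f p)) / 4"
proof -
  have eq: "wirtinger_bar l f =
      (\<lambda>q. (iter_deriv [axis l 1] f q + \<i> * iter_deriv [axis l \<i>] f q) / 2)"
    by (simp add: wirtinger_bar_def fun_eq_iff iter_deriv.simps)
  have "(wirtinger_bar l f has_derivative
      (\<lambda>v. (iter_deriv [v, axis l 1] f p + \<i> * iter_deriv [v, axis l \<i>] f p) / 2)) (at p)"
    unfolding eq divide_inverse
    by (intro has_derivative_mult_left has_derivative_add has_derivative_mult_right
        Ck_on_2_has_derivative[OF S(2,3)])
  from frechet_derivative_at[OF this, symmetric] show ?thesis
    unfolding wirtinger_def by (simp add: field_simps)
qed

lemma vec_complex_expansion: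
  "(v :: complex ^ 'k::finite) = (\<Sum>j\<in>UNIV. Re (v $ j) *\<^sub>R axis j 1 + Im (v $ j) *\<^sub>R axis j \<i>)"
  by (simp add: vec_eq_iff axis_def if_distrib[of "\<lambda>x. _ *\<^sub>R x"] complex_eq_iff
      Re_sum Im_sum if_distrib[of Re] if_distrib[of Im] sum.delta cong: if_cong)

text \<open>\<open>H\<close> is bilinear over the reals only, so both \<open>axis j 1\<close> and
  \<open>axis j \<i>\<close> serve as basis vectors and each pair of indices yields four
  terms.\<close>

lemma bilinear_complex_expansion:
  fixes H :: "complex ^ 'k::finite \<Rightarrow> complex ^ 'k \<Rightarrow> complex"
  assumes "bilinear H"
  shows "H v w = (\<Sum>j\<in>UNIV. \<Sum>l\<in>UNIV.
      of_real (Re (v $ j) * Re (w $ l)) * H (axis j 1) (axis l 1)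
    + of_real (Re (v $ j) * Im (w $ l)) * H (axis j 1) (axis l \<i>)
    + of_real (Im (v $ j) * Re (w $ l)) * H (axis j \<i>) (axis l 1)
    + of_real (Im (v $ j) * Im (w $ l)) * H (axis j \<i>) (axis l \<i>))"
proof -
  have "H v w = H (\<Sum>j\<in>UNIV. Re (v $ j) *\<^sub>R axis j 1 + Im (v $ j) *\<^sub>R axis j \<i>)
      (\<Sum>j\<in>UNIV. Re (w $ j) *\<^sub>R axis j 1 + Im (w $ j) *\<^sub>R axis j \<i>)"
    by (rule arg_cong2[of v _ w _ H, OF vec_complex_expansion vec_complex_expansion])
  also have "\<dots> = (\<Sum>j\<in>UNIV. \<Sum>l\<in>UNIV. H (Re (v $ j) *\<^sub>R axis j 1 + Im (v $ j) *\<^sub>R axis j \<i>)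
      (Re (w $ l) *\<^sub>R axis l 1 + Im (w $ l) *\<^sub>R axis l \<i>))"
    unfolding bilinear_sum[OF assms] sum.cartesian_product ..
  finally show ?thesis
    unfolding bilinear_ladd[OF assms] bilinear_radd[OF assms] bilinear_lmul[OF assms]
        bilinear_rmul[OF assms]
    by (simp add: scaleR_conv_of_real algebra_simps)
qed

definition levi_matrix :: "(complex ^ 'k::finite \<Rightarrow> complex) \<Rightarrow> complex ^ 'k \<Rightarrow> complex ^ 'k ^ 'k" where
  "levi_matrix f p = (\<chi> j l. wirtinger j (wirtinger_bar l f) p)"

text \<open>Both sides are expanded in the real basis and agree for each pair of indices separately.
  The antisymmetric term stays, since symmetry of second derivatives is proved for real-valued
  functions; it cancels in \<open>sesq_i_ddbar\<close>.\<close>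

lemma sesq_levi_matrix:
  assumes S: "open S" "Ck_on 2 S f" "p \<in> S"
  shows "sesq (levi_matrix f p) v v =
    (iter_deriv [v, v] f p + iter_deriv [\<i> *s v, \<i> *s v] f p
      + \<i> * (iter_deriv [v, \<i> *s v] f p - iter_deriv [\<i> *s v, v] f p)) / 4"
proof -
  define H where "H a b = iter_deriv [a, b] f p" for a b
  have bil: "bilinear H" using bilinear_iter_deriv[OF S] by (simp add: H_def [abs_def])
  have e: "levi_matrix f p $ j $ l = (H (axis j 1) (axis l 1) + H (axis j \<i>) (axis l \<i>)
      + \<i> * (H (axis j 1) (axis l \<i>) - H (axis j \<i>) (axis l 1))) / 4" for j l
    using wirtinger_wirtinger_bar[OF S] unfolding levi_matrix_def H_def by simp
  have "H v v + H (\<i> *s v) (\<i> *s v) + \<i> * (H v (\<i> *s v) - H (\<i> *s v) v)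
      = 4 * sesq (levi_matrix f p) v v"
    unfolding sesq_def e bilinear_complex_expansion[OF bil, of v v]
      bilinear_complex_expansion[OF bil, of v "\<i> *s v"] bilinear_complex_expansion[OF bil, of "\<i> *s v" v]
      bilinear_complex_expansion[OF bil, of "\<i> *s v" "\<i> *s v"]
      sum_distrib_left sum.distrib[symmetric] sum_subtractf[symmetric]
  proof (intro sum.cong refl, goal_cases)
    case (1 j l)
    define a b c d where ab: "a = Re (v $ j)" "b = Im (v $ j)" "c = Re (v $ l)" "d = Im (v $ l)"
    have re: "v $ j = a + \<i> * b" "cnj (v $ l) = c - \<i> * d"
      by (simp_all add: ab complex_eq_iff)
    have "Re ((\<i> *s v) $ j) = - b" "Im ((\<i> *s v) $ j) = a" "Re ((\<i> *s v) $ l) = - d" "Im ((\<i> *s v) $ l) = c"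
      by (simp_all add: ab)
    then show ?case
      unfolding re ab[symmetric] by (simp add: algebra_simps)
  qed
  then show ?thesis by (simp add: H_def)
qed

section \<open>Positive functionals on bounded functions\<close>

text \<open>The functions are total; their values off \<open>X\<close> are unconstrained.\<close>

definition bdd_fun :: "'a set \<Rightarrow> ('a \<Rightarrow> real) set" where
  "bdd_fun X = {f. bounded (f ` X)}"

lemma bdd_funI: "(\<And>x. x \<in> X \<Longrightarrow> \<bar>f x\<bar> \<le> b) \<Longrightarrow> f \<in> bdd_fun X"
  by (auto simp: bdd_fun_def bounded_iff)

lemma bdd_funE:
  assumes "f \<in> bdd_fun X"
  obtains b where "b > 0" "\<And>x. x \<in> X \<Longrightarrow> \<bar>f x\<bar> \<le> b"
  using assms by (auto simp: bdd_fun_def bounded_pos)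

lemma bdd_fun_intros [intro, simp]:
  shows bdd_fun_const: "(\<lambda>_. c) \<in> bdd_fun X"
    and bdd_fun_add: "f \<in> bdd_fun X \<Longrightarrow> g \<in> bdd_fun X \<Longrightarrow> (\<lambda>x. f x + g x) \<in> bdd_fun X"
    and bdd_fun_scale: "f \<in> bdd_fun X \<Longrightarrow> (\<lambda>x. c * f x) \<in> bdd_fun X"
    and bdd_fun_minus: "f \<in> bdd_fun X \<Longrightarrow> (\<lambda>x. - f x) \<in> bdd_fun X"
    and bdd_fun_diff: "f \<in> bdd_fun X \<Longrightarrow> g \<in> bdd_fun X \<Longrightarrow> (\<lambda>x. f x - g x) \<in> bdd_fun X"
    and bdd_fun_indicator: "f \<in> bdd_fun X \<Longrightarrow> (\<lambda>x. indicator S x * f x) \<in> bdd_fun X"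
proof -
  show const: "(\<lambda>_. c) \<in> bdd_fun X" for c by (rule bdd_funI[of _ _ "\<bar>c\<bar>"]) simp
  show add: "(\<lambda>x. f x + g x) \<in> bdd_fun X" if f: "f \<in> bdd_fun X" and g: "g \<in> bdd_fun X" for f g
  proof -
    obtain b where "\<And>x. x \<in> X \<Longrightarrow> \<bar>f x\<bar> \<le> b" using f by (rule bdd_funE) blast
    moreover obtain c where "\<And>x. x \<in> X \<Longrightarrow> \<bar>g x\<bar> \<le> c" using g by (rule bdd_funE) blast
    ultimately show ?thesis by (intro bdd_funI[of _ _ "b + c"]) (rule abs_triangle_ineq[THEN order_trans], simp add: add_mono)
  qed
  show scale: "(\<lambda>x. c * f x) \<in> bdd_fun X" if f: "f \<in> bdd_fun X" for f c
  proof -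
    obtain b where "\<And>x. x \<in> X \<Longrightarrow> \<bar>f x\<bar> \<le> b" using f by (rule bdd_funE) blast
    then show ?thesis by (intro bdd_funI[of _ _ "\<bar>c\<bar> * b"]) (simp add: abs_mult mult_left_mono)
  qed
  show min: "(\<lambda>x. - f x) \<in> bdd_fun X" if "f \<in> bdd_fun X" for f
    using scale[OF that, of "-1"] by simp
  show "(\<lambda>x. f x - g x) \<in> bdd_fun X" if "f \<in> bdd_fun X" "g \<in> bdd_fun X"
    using add[OF that(1) min[OF that(2)]] by simp
  show "(\<lambda>x. indicator S x * f x) \<in> bdd_fun X" if f: "f \<in> bdd_fun X"
  proof -
    obtain b where "b > 0" "\<And>x. x \<in> X \<Longrightarrow> \<bar>f x\<bar> \<le> b" using f by (rule bdd_funE) blast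
    then show ?thesis by (intro bdd_funI[of _ _ b]) (auto simp: indicator_def abs_mult)
  qed
qed

section \<open>Sublinear functionals and their minimal elements\<close>

text \<open>Homogeneity is demanded as an inequality only, which infima inherit easily; for
  \<open>c > 0\<close> the reverse inequality follows by applying it with \<open>1 / c\<close>, and
  the value at 0 is forced to be 0.\<close>

definition sublinear_on :: "'a set \<Rightarrow> (('a \<Rightarrow> real) \<Rightarrow> real) \<Rightarrow> bool" where
  "sublinear_on X q \<longleftrightarrow>
     (\<forall>f\<in>bdd_fun X. \<forall>g\<in>bdd_fun X. q (\<lambda>x. f x + g x) \<le> q f + q g) \<and>
     (\<forall>f\<in>bdd_fun X. \<forall>c\<ge>0. q (\<lambda>x. c * f x) \<le> c * q f)"

lemma sublinear_onD:
  assumes "sublinear_on X q"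
  shows "f \<in> bdd_fun X \<Longrightarrow> g \<in> bdd_fun X \<Longrightarrow> q (\<lambda>x. f x + g x) \<le> q f + q g"
    and "f \<in> bdd_fun X \<Longrightarrow> c \<ge> 0 \<Longrightarrow> q (\<lambda>x. c * f x) \<le> c * q f"
    and "q (\<lambda>_. 0) = 0"
    and "f \<in> bdd_fun X \<Longrightarrow> - q (\<lambda>x. - f x) \<le> q f"
proof -
  show add: "f \<in> bdd_fun X \<Longrightarrow> g \<in> bdd_fun X \<Longrightarrow> q (\<lambda>x. f x + g x) \<le> q f + q g"
    and scale: "f \<in> bdd_fun X \<Longrightarrow> c \<ge> 0 \<Longrightarrow> q (\<lambda>x. c * f x) \<le> c * q f" for f g c
    using assms by (auto simp: sublinear_on_def)
  show zero: "q (\<lambda>_. 0) = 0"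
    using add[of "\<lambda>_. 0" "\<lambda>_. 0"] scale[of "\<lambda>_. 0" 0] by simp
  show "f \<in> bdd_fun X \<Longrightarrow> - q (\<lambda>x. - f x) \<le> q f"
    using add[of f "\<lambda>x. - f x"] zero by simp
qed

text \<open>Zorn's lemma, with pointwise infima of chains as bounds. It takes the place of the
  Hahn-Banach theorem, because a minimal sublinear functional turns out to be additive.\<close>

lemma minimal_sublinear:
  assumes p: "sublinear_on X p"
  obtains q where "sublinear_on X q" "\<And>f. f \<in> bdd_fun X \<Longrightarrow> q f \<le> p f"
    "\<And>r f. sublinear_on X r \<Longrightarrow> (\<And>f. f \<in> bdd_fun X \<Longrightarrow> r f \<le> q f) \<Longrightarrow> f \<in> bdd_fun X \<Longrightarrow> r f = q f"
proof -
  \<comment> \<open>Fixing the value 0 off \<open>bdd_fun X\<close> makes the pointwise order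
    antisymmetric on \<open>A\<close>.\<close>
  define A where "A = {q. sublinear_on X q \<and> (\<forall>f\<in>bdd_fun X. q f \<le> p f) \<and> (\<forall>f. f \<notin> bdd_fun X \<longrightarrow> q f = 0)}"
  \<comment> \<open>The order is reversed, so that the maximal element supplied by Zorn's lemma is a
    minimal functional.\<close>
  define P where "P a b \<longleftrightarrow> (\<forall>f. b f \<le> a f)" for a b :: "('a \<Rightarrow> real) \<Rightarrow> real"
  define restr where "restr q f = (if f \<in> bdd_fun X then q f else 0)" for q :: "('a \<Rightarrow> real) \<Rightarrow> real" and f
  have restr: "sublinear_on X (restr q)" if "sublinear_on X q" for q
    using that by (simp add: sublinear_on_def restr_def)
  \<comment> \<open>A lower bound independent of \<open>q\<close>: this keeps the infimum over a
    chain finite.\<close>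
  have lower: "- p (\<lambda>x. - f x) \<le> q f" if "q \<in> A" "f \<in> bdd_fun X" for q f
  proof -
    have "- q (\<lambda>x. - f x) \<le> q f" "q (\<lambda>x. - f x) \<le> p (\<lambda>x. - f x)"
      using that by (auto simp: A_def intro: sublinear_onD)
    then show ?thesis by linarith
  qed
  have "\<exists>m\<in>A. \<forall>a\<in>A. P m a \<longrightarrow> a = m"
  proof (rule predicate_Zorn)
    show "partial_order_on A (relation_of P A)"
      unfolding partial_order_on_def preorder_on_def
    proof (intro conjI)
      show "refl_on A (relation_of P A)"
        by (auto simp: refl_on_def relation_of_def P_def)
      show "trans (relation_of P A)"
        unfolding trans_def relation_of_def P_def by (auto intro: order_trans)
      show "antisym (relation_of P A)"
        unfolding antisym_def relation_of_def P_def by (auto intro!: ext antisym)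
    qed (auto simp: relation_of_def)
    fix C assume C: "C \<in> Chains (relation_of P A)"
    then have CA: "C \<subseteq> A" by (auto simp: Chains_def relation_of_def)
    show "\<exists>u\<in>A. \<forall>a\<in>C. P a u"
    proof (cases "C = {}")
      case True
      have "restr p \<in> A" using restr[OF p] by (auto simp: A_def restr_def)
      then show ?thesis using True by blast
    next
      case False
      define u where "u f = (INF q\<in>C. q f)" for f
      have bdd: "bdd_below ((\<lambda>q. q f) ` C)" for f
      proof (cases "f \<in> bdd_fun X")
        case True
        then show ?thesis using lower CA by (intro bdd_belowI2[of _ "- p (\<lambda>x. - f x)"]) auto
      next
        case False
        then show ?thesis using CA by (intro bdd_belowI2[of _ 0]) (auto simp: A_def)
      qed
      have u_le: "u f \<le> q f" if "q \<in> C" for q f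
        unfolding u_def using that by (intro cINF_lower bdd)
      have u_ge: "c \<le> u f" if "\<And>q. q \<in> C \<Longrightarrow> c \<le> q f" for c f
        unfolding u_def using that False by (intro cINF_greatest)
      have "sublinear_on X u"
        unfolding sublinear_on_def
      proof (intro conjI ballI allI impI)
        fix f g assume fg: "f \<in> bdd_fun X" "g \<in> bdd_fun X"
        have *: "u (\<lambda>x. f x + g x) \<le> q1 f + q2 g" if q: "q1 \<in> C" "q2 \<in> C" for q1 q2
        proof -
          \<comment> \<open>Two members of a chain are comparable, so the smaller one lies below
            both, and its subadditivity applies to both summands at once.\<close>
          obtain q where "q \<in> C" "q f \<le> q1 f" "q g \<le> q2 g"
            using C q unfolding Chains_def relation_of_def P_def by fastforce
          moreover have "q (\<lambda>x. f x + g x) \<le> q f + q g"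
            using \<open>q \<in> C\<close> CA fg by (auto simp: A_def intro: sublinear_onD)
          ultimately show ?thesis using u_le[of q "\<lambda>x. f x + g x"] by linarith
        qed
        have "u (\<lambda>x. f x + g x) - q2 g \<le> u f" if "q2 \<in> C" for q2
          by (rule u_ge) (use *[OF _ that] in \<open>auto simp: algebra_simps\<close>)
        then have "u (\<lambda>x. f x + g x) - u f \<le> u g"
          by (intro u_ge) (auto simp: algebra_simps)
        then show "u (\<lambda>x. f x + g x) \<le> u f + u g" by simp
      next
        fix f and c :: real assume f: "f \<in> bdd_fun X" and "0 \<le> c"
        have *: "u (\<lambda>x. c * f x) \<le> c * q f" if "q \<in> C" for q
          using u_le[OF that, of "\<lambda>x. c * f x"] sublinear_onD(2)[of X q f c] that CA f \<open>0 \<le> c\<close>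
          by (force simp: A_def)
        show "u (\<lambda>x. c * f x) \<le> c * u f"
        proof (cases "c = 0")
          case True
          then show ?thesis using * False by auto
        next
          case False
          then have "u (\<lambda>x. c * f x) / c \<le> u f"
            using * \<open>0 \<le> c\<close> by (intro u_ge) (auto simp: field_simps)
          then show ?thesis using False \<open>0 \<le> c\<close> by (auto simp: field_simps)
        qed
      qed
      moreover have "u f \<le> p f" if "f \<in> bdd_fun X" for f
      proof -
        obtain q where "q \<in> C" using False by blast
        then show ?thesis using u_le[of q f] CA that by (force simp: A_def)
      qed
      moreover have "u f = 0" if "f \<notin> bdd_fun X" for f
      proof -
        have "q f = 0" if "q \<in> C" for q using that CA \<open>f \<notin> bdd_fun X\<close> by (auto simp: A_def)
        then have "(\<lambda>q. q f) ` C = (\<lambda>_. 0) ` C" by (intro image_cong) auto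
        then show ?thesis using False by (simp add: u_def image_constant_conv)
      qed
      ultimately have "u \<in> A" by (simp add: A_def)
      then show ?thesis using u_le by (auto simp: P_def)
    qed
  qed
  then obtain q where q: "q \<in> A" "\<And>a. a \<in> A \<Longrightarrow> P q a \<Longrightarrow> a = q" by blast
  show ?thesis
  proof (rule that)
    show "sublinear_on X q" "\<And>f. f \<in> bdd_fun X \<Longrightarrow> q f \<le> p f" using q(1) by (auto simp: A_def)
    fix r f assume r: "sublinear_on X r" "\<And>f. f \<in> bdd_fun X \<Longrightarrow> r f \<le> q f" and f: "f \<in> bdd_fun X"
    have "restr r \<in> A"
      using restr[OF r(1)] r(2) q(1) by (force simp: A_def restr_def)
    moreover have "P q (restr r)" using r(2) q(1) by (auto simp: P_def restr_def A_def)
    ultimately have "restr r = q" by (rule q(2))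
    then show "r f = q f" using f by (auto simp: restr_def)
  qed
qed

text \<open>For fixed \<open>g\<close>, the functional \<open>f \<mapsto> inf\<^bsub>t \<ge> 0\<^esub> (q (f + t g) - t q g)\<close> is sublinear and below \<open>q\<close>,
  so it equals \<open>q\<close>; take \<open>t = 1\<close>.\<close>

lemma minimal_sublinear_additive:
  assumes q: "sublinear_on X q"
    and min: "\<And>r f. sublinear_on X r \<Longrightarrow> (\<And>f. f \<in> bdd_fun X \<Longrightarrow> r f \<le> q f) \<Longrightarrow> f \<in> bdd_fun X \<Longrightarrow> r f = q f"
    and f: "f \<in> bdd_fun X" and g: "g \<in> bdd_fun X"
  shows "q (\<lambda>x. f x + g x) = q f + q g"
proof (rule antisym)
  define r where "r f = (INF t\<in>{0::real..}. q (\<lambda>x. f x + t * g x) - t * q g)" for f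
  have bdd: "bdd_below ((\<lambda>t. q (\<lambda>x. f x + t * g x) - t * q g) ` {0..})" if f: "f \<in> bdd_fun X" for f
  proof (intro bdd_belowI2[of _ "- q (\<lambda>x. - f x)"])
    fix t :: real assume t: "t \<in> {0..}"
    \<comment> \<open>The reverse half of homogeneity, from scaling \<open>t * g\<close> by
      \<open>1 / t\<close>.\<close>
    have "t * q g \<le> q (\<lambda>x. t * g x)"
    proof (cases "t = 0")
      case False
      then show ?thesis
        using sublinear_onD(2)[OF q, of "\<lambda>x. t * g x" "1 / t"] t g by (auto simp: field_simps)
    qed (simp add: sublinear_onD(3)[OF q])
    moreover have "q (\<lambda>x. t * g x) \<le> q (\<lambda>x. f x + t * g x) + q (\<lambda>x. - f x)"
      using sublinear_onD(1)[OF q, of "\<lambda>x. f x + t * g x" "\<lambda>x. - f x"] f g by simp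
    ultimately show "- q (\<lambda>x. - f x) \<le> q (\<lambda>x. f x + t * g x) - t * q g" by linarith
  qed
  have r_le: "r f \<le> q (\<lambda>x. f x + t * g x) - t * q g" if "f \<in> bdd_fun X" "t \<ge> 0" for f t
    unfolding r_def using that by (intro cINF_lower bdd) auto
  have r_ge: "c \<le> r f" if "\<And>t. t \<ge> 0 \<Longrightarrow> c \<le> q (\<lambda>x. f x + t * g x) - t * q g" for c f
    unfolding r_def using that by (intro cINF_greatest) auto
  have "sublinear_on X r"
    unfolding sublinear_on_def
  proof (intro conjI ballI allI impI)
    fix h k assume hk: "h \<in> bdd_fun X" "k \<in> bdd_fun X"
    have *: "r (\<lambda>x. h x + k x) \<le> (q (\<lambda>x. h x + s * g x) - s * q g) + (q (\<lambda>x. k x + t * g x) - t * q g)"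
      if st: "s \<ge> 0" "t \<ge> 0" for s t
    proof -
      \<comment> \<open>The parameters add up: the competitor \<open>s + t\<close> for the sum
        splits into \<open>s\<close> for \<open>h\<close> and \<open>t\<close> for
        \<open>k\<close>.\<close>
      have "r (\<lambda>x. h x + k x) \<le> q (\<lambda>x. (h x + k x) + (s + t) * g x) - (s + t) * q g"
        using hk st by (intro r_le) auto
      also have "(\<lambda>x. (h x + k x) + (s + t) * g x) = (\<lambda>x. (h x + s * g x) + (k x + t * g x))"
        by (auto simp: algebra_simps)
      also have "q \<dots> \<le> q (\<lambda>x. h x + s * g x) + q (\<lambda>x. k x + t * g x)"
        using hk g by (intro sublinear_onD(1)[OF q]) auto
      finally show ?thesis by (simp add: algebra_simps)
    qed
    have "r (\<lambda>x. h x + k x) - (q (\<lambda>x. k x + t * g x) - t * q g) \<le> r h" if "t \<ge> 0" for t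
      by (rule r_ge) (use *[OF _ that] in \<open>simp add: algebra_simps\<close>)
    then have "r (\<lambda>x. h x + k x) - r h \<le> r k"
      by (intro r_ge) (simp add: algebra_simps)
    then show "r (\<lambda>x. h x + k x) \<le> r h + r k" by simp
  next
    fix h and c :: real assume h: "h \<in> bdd_fun X" and c: "0 \<le> c"
    have *: "r (\<lambda>x. c * h x) \<le> c * (q (\<lambda>x. h x + t * g x) - t * q g)" if "t \<ge> 0" for t
    proof -
      have "r (\<lambda>x. c * h x) \<le> q (\<lambda>x. c * h x + (c * t) * g x) - (c * t) * q g"
        using h c that by (intro r_le) auto
      also have "(\<lambda>x. c * h x + (c * t) * g x) = (\<lambda>x. c * (h x + t * g x))"
        by (auto simp: algebra_simps)
      also have "q \<dots> \<le> c * q (\<lambda>x. h x + t * g x)"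
        using h g c by (intro sublinear_onD(2)[OF q]) auto
      finally show ?thesis by (simp add: algebra_simps)
    qed
    show "r (\<lambda>x. c * h x) \<le> c * r h"
    proof (cases "c = 0")
      case True
      then show ?thesis using *[of 0] by simp
    next
      case False
      then have "r (\<lambda>x. c * h x) / c \<le> r h"
        using * c by (intro r_ge) (simp add: pos_divide_le_eq mult.commute)
      then show ?thesis using False c by (simp add: pos_divide_le_eq mult.commute)
    qed
  qed
  moreover have "r h \<le> q h" if "h \<in> bdd_fun X" for h
    using r_le[OF that, of 0] by simp
  ultimately have "r f = q f" using f by (rule min)
  then show "q f + q g \<le> q (\<lambda>x. f x + g x)"
    using r_le[OF f, of 1] by simp
  show "q (\<lambda>x. f x + g x) \<le> q f + q g" by (rule sublinear_onD(1)[OF q f g])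
qed

section \<open>Finitely additive integrals and the extension theorem of M. Riesz\<close>

text \<open>An integral for a finitely additive measure on all subsets of \<open>X\<close>, applied
  to bounded functions.\<close>

locale positive_functional =
  fixes X :: "'a set" and \<Lambda> :: "('a \<Rightarrow> real) \<Rightarrow> real"
  assumes add: "f \<in> bdd_fun X \<Longrightarrow> g \<in> bdd_fun X \<Longrightarrow> \<Lambda> (\<lambda>x. f x + g x) = \<Lambda> f + \<Lambda> g"
    and scale: "f \<in> bdd_fun X \<Longrightarrow> \<Lambda> (\<lambda>x. c * f x) = c * \<Lambda> f"
    and nonneg: "f \<in> bdd_fun X \<Longrightarrow> (\<And>x. x \<in> X \<Longrightarrow> 0 \<le> f x) \<Longrightarrow> 0 \<le> \<Lambda> f"
begin

lemma minus: "f \<in> bdd_fun X \<Longrightarrow> \<Lambda> (\<lambda>x. - f x) = - \<Lambda> f"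
  using scale[of f "-1"] by simp

lemma diff: "f \<in> bdd_fun X \<Longrightarrow> g \<in> bdd_fun X \<Longrightarrow> \<Lambda> (\<lambda>x. f x - g x) = \<Lambda> f - \<Lambda> g"
  using add[of f "\<lambda>x. - g x"] minus[of g] by simp

lemma zero: "\<Lambda> (\<lambda>_. 0) = 0"
  using scale[of "\<lambda>_. 0" 0] by simp

lemma mono:
  assumes "f \<in> bdd_fun X" "g \<in> bdd_fun X" "\<And>x. x \<in> X \<Longrightarrow> f x \<le> g x"
  shows "\<Lambda> f \<le> \<Lambda> g"
  using nonneg[of "\<lambda>x. g x - f x"] assms diff[of g f] by simp

text \<open>\<open>nonneg\<close> tests the sign on \<open>X\<close> only, hence
  \<open>\<Lambda>\<close> cannot see values off \<open>X\<close>.\<close>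

lemma cong:
  assumes "f \<in> bdd_fun X" "\<And>x. x \<in> X \<Longrightarrow> f x = g x"
  shows "\<Lambda> f = \<Lambda> g"
proof -
  have "g \<in> bdd_fun X" using assms by (simp add: bdd_fun_def cong: image_cong)
  with assms show ?thesis by (intro antisym mono) auto
qed

lemma abs_le:
  assumes "\<And>x. x \<in> X \<Longrightarrow> \<bar>f x\<bar> \<le> c"
  shows "\<bar>\<Lambda> f\<bar> \<le> c * \<Lambda> (\<lambda>_. 1)"
proof -
  have f: "f \<in> bdd_fun X" using assms by (rule bdd_funI)
  have "\<Lambda> f \<le> \<Lambda> (\<lambda>_. c * 1)" "\<Lambda> (\<lambda>_. - c * 1) \<le> \<Lambda> f"
    using f assms by (intro mono; force)+
  then show ?thesis using scale[of "\<lambda>_. 1" c] scale[of "\<lambda>_. 1" "- c"] by auto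
qed

lemma sum:
  assumes "finite I" "\<And>i. i \<in> I \<Longrightarrow> f i \<in> bdd_fun X"
  shows "(\<lambda>x. \<Sum>i\<in>I. f i x) \<in> bdd_fun X \<and> \<Lambda> (\<lambda>x. \<Sum>i\<in>I. f i x) = (\<Sum>i\<in>I. \<Lambda> (f i))"
  using assms by (induction I) (auto simp: zero add)

end

text \<open>\<open>V\<close> is the graph of a positive linear functional on a subspace;
  \<open>V_pos\<close>, applied to differences, makes it single-valued. \<open>p f\<close> is the
  infimum of the values on majorants of \<open>f\<close> in this subspace. Multiples of the order
  unit \<open>e\<close> provide a majorant and bound those values from below. A linear functional
  below \<open>p\<close> agrees with \<open>V\<close> (test \<open>f\<close> and
  \<open>- f\<close>), and it is positive since \<open>- f\<close> has the majorant 0 whenever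
  \<open>f\<close> is nonnegative.\<close>

lemma positive_extension:
  fixes V :: "(('a \<Rightarrow> real) \<times> real) set"
  assumes V_bdd: "\<And>f a. (f, a) \<in> V \<Longrightarrow> f \<in> bdd_fun X"
    and V_add: "\<And>f a g b. (f, a) \<in> V \<Longrightarrow> (g, b) \<in> V \<Longrightarrow> (\<lambda>x. f x + g x, a + b) \<in> V"
    and V_scale: "\<And>f a c. (f, a) \<in> V \<Longrightarrow> (\<lambda>x. c * f x, c * a) \<in> V"
    and V_pos: "\<And>f a. (f, a) \<in> V \<Longrightarrow> (\<And>x. x \<in> X \<Longrightarrow> 0 \<le> f x) \<Longrightarrow> 0 \<le> a"
    and e: "(e, e0) \<in> V" "\<And>x. x \<in> X \<Longrightarrow> 1 \<le> e x"
  obtains \<Lambda> where "positive_functional X \<Lambda>" "\<And>f a. (f, a) \<in> V \<Longrightarrow> \<Lambda> f = a"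
proof -
  define M where "M f = {a. \<exists>g. (g, a) \<in> V \<and> (\<forall>x\<in>X. f x \<le> g x)}" for f
  define p where "p f = Inf (M f)" for f
  have e_ge: "c \<le> c * e x" if "c \<ge> 0" "x \<in> X" for c x
    using mult_left_mono[OF e(2)[OF that(2)] that(1)] by simp
  have ne: "M f \<noteq> {}" if f: "f \<in> bdd_fun X" for f
  proof -
    obtain b where b: "b > 0" "\<And>x. x \<in> X \<Longrightarrow> \<bar>f x\<bar> \<le> b" using f by (rule bdd_funE) blast
    have "f x \<le> b * e x" if "x \<in> X" for x
      using b(2)[OF that] e_ge[OF _ that, of b] b(1) by linarith
    then show ?thesis using V_scale[OF e(1), of b] by (auto simp: M_def)
  qed
  have bdd: "bdd_below (M f)" if f: "f \<in> bdd_fun X" for f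
  proof -
    obtain b where b: "b > 0" "\<And>x. x \<in> X \<Longrightarrow> \<bar>f x\<bar> \<le> b" using f by (rule bdd_funE) blast
    have "- (b * e0) \<le> a" if "a \<in> M f" for a
    proof -
      obtain g where g: "(g, a) \<in> V" "\<And>x. x \<in> X \<Longrightarrow> f x \<le> g x" using \<open>a \<in> M f\<close> by (auto simp: M_def)
      have "0 \<le> a + b * e0"
      proof (rule V_pos[OF V_add[OF g(1) V_scale[OF e(1), of b]]])
        show "0 \<le> g x + b * e x" if "x \<in> X" for x
          using g(2)[OF that] b(2)[OF that] e_ge[OF _ that, of b] b(1) by linarith
      qed
      then show ?thesis by simp
    qed
    then show ?thesis by (rule bdd_belowI)
  qed
  have p_le: "p f \<le> a" if "f \<in> bdd_fun X" "(g, a) \<in> V" "\<And>x. x \<in> X \<Longrightarrow> f x \<le> g x" for f g a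
    unfolding p_def using that by (intro cInf_lower bdd) (auto simp: M_def)
  have p_ge: "c \<le> p f" if "f \<in> bdd_fun X" "\<And>g a. (g, a) \<in> V \<Longrightarrow> (\<And>x. x \<in> X \<Longrightarrow> f x \<le> g x) \<Longrightarrow> c \<le> a" for c f
    unfolding p_def using that by (intro cInf_greatest ne) (auto simp: M_def)
  have zero: "(\<lambda>_. 0, 0) \<in> V" using V_scale[OF e(1), of 0] by simp
  have "sublinear_on X p"
    unfolding sublinear_on_def
  proof (intro conjI ballI allI impI)
    fix f g assume fg: "f \<in> bdd_fun X" "g \<in> bdd_fun X"
    have *: "p (\<lambda>x. f x + g x) \<le> a + b"
      if "(f', a) \<in> V" "(g', b) \<in> V" "\<And>x. x \<in> X \<Longrightarrow> f x \<le> f' x" "\<And>x. x \<in> X \<Longrightarrow> g x \<le> g' x" for f' g' a b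
      using fg V_add[OF that(1,2)] that(3,4) by (intro p_le[where g = "\<lambda>x. f' x + g' x"]) (auto intro: add_mono)
    have "p (\<lambda>x. f x + g x) - b \<le> p f"
      if "(g', b) \<in> V" "\<And>x. x \<in> X \<Longrightarrow> g x \<le> g' x" for g' b
      by (rule p_ge[OF fg(1)]) (use *[OF _ that(1) _ that(2)] in \<open>auto simp: algebra_simps\<close>)
    then have "p (\<lambda>x. f x + g x) - p f \<le> p g"
      by (intro p_ge[OF fg(2)]) (auto simp: algebra_simps)
    then show "p (\<lambda>x. f x + g x) \<le> p f + p g" by simp
  next
    fix f and c :: real assume f: "f \<in> bdd_fun X" and c: "0 \<le> c"
    have *: "p (\<lambda>x. c * f x) \<le> c * a" if "(g, a) \<in> V" "\<And>x. x \<in> X \<Longrightarrow> f x \<le> g x" for g a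
      using f c V_scale[OF that(1)] that(2) by (intro p_le[where g = "\<lambda>x. c * g x"]) (auto intro: mult_left_mono)
    show "p (\<lambda>x. c * f x) \<le> c * p f"
    proof (cases "c = 0")
      case True
      then show ?thesis using p_le[OF _ zero, of "\<lambda>_. 0"] by simp
    next
      case False
      then have "p (\<lambda>x. c * f x) / c \<le> p f"
        using * c by (intro p_ge[OF f]) (simp add: pos_divide_le_eq mult.commute)
      then show ?thesis using False c by (simp add: pos_divide_le_eq mult.commute)
    qed
  qed
  then obtain q where q: "sublinear_on X q" "\<And>f. f \<in> bdd_fun X \<Longrightarrow> q f \<le> p f"
    "\<And>r f. sublinear_on X r \<Longrightarrow> (\<And>f. f \<in> bdd_fun X \<Longrightarrow> r f \<le> q f) \<Longrightarrow> f \<in> bdd_fun X \<Longrightarrow> r f = q f"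
    by (rule minimal_sublinear) blast
  have add: "q (\<lambda>x. f x + g x) = q f + q g" if "f \<in> bdd_fun X" "g \<in> bdd_fun X" for f g
    using q(1) q(3) that by (rule minimal_sublinear_additive)
  have minus: "q (\<lambda>x. - f x) = - q f" if "f \<in> bdd_fun X" for f
    using add[OF that bdd_fun_minus[OF that]] sublinear_onD(3)[OF q(1)] by simp
  have pos_scale: "q (\<lambda>x. c * f x) = c * q f" if f: "f \<in> bdd_fun X" and "c \<ge> 0" for f c
  proof (rule antisym)
    show "q (\<lambda>x. c * f x) \<le> c * q f" by (rule sublinear_onD(2)[OF q(1) that])
    have "q (\<lambda>x. c * - f x) \<le> c * q (\<lambda>x. - f x)" by (rule sublinear_onD(2)[OF q(1)]) (use that in auto)
    then show "c * q f \<le> q (\<lambda>x. c * f x)" using minus[OF f] minus[of "\<lambda>x. c * f x"] f by simp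
  qed
  show ?thesis
  proof (rule that)
    show "positive_functional X q"
    proof
      fix f and c :: real assume f: "f \<in> bdd_fun X"
      show "q (\<lambda>x. c * f x) = c * q f"
      proof (cases "c \<ge> 0")
        case False
        then show ?thesis using pos_scale[of "\<lambda>x. - f x" "- c"] f minus[OF f] by simp
      qed (simp add: pos_scale f)
      assume "\<And>x. x \<in> X \<Longrightarrow> 0 \<le> f x"
      then have "p (\<lambda>x. - f x) \<le> 0" using f by (intro p_le[OF _ zero]) auto
      then show "0 \<le> q f" using q(2)[of "\<lambda>x. - f x"] minus[OF f] f by simp
    qed (rule add)
    fix f a assume fa: "(f, a) \<in> V"
    have f: "f \<in> bdd_fun X" using fa by (rule V_bdd)
    have "q f \<le> a" using q(2)[OF f] p_le[OF f fa] by simp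
    moreover have "q (\<lambda>x. - f x) \<le> - a"
      using q(2)[of "\<lambda>x. - f x"] p_le[OF _ V_scale[OF fa, of "-1"], of "\<lambda>x. - f x"] f by auto
    ultimately show "q f = a" using minus[OF f] by simp
  qed
qed

section \<open>Riesz representation on compact second countable Hausdorff spaces\<close>

definition quaternary :: "(nat \<Rightarrow> bool) \<Rightarrow> real" where
  "quaternary x = (\<Sum>n. of_bool (x n) / 4 ^ Suc n)"

lemma summable_quaternary: "summable (\<lambda>n. of_bool (x n) / 4 ^ Suc n :: real)"
  by (rule summable_comparison_test'[OF summable_geometric[of "1/4 :: real"], of 0])
     (auto simp: of_bool_def power_divide divide_simps)

lemma quaternary_bounds: "0 \<le> quaternary x" "quaternary x \<le> 1 / 3"
proof -
  show "0 \<le> quaternary x" unfolding quaternary_def by (intro suminf_nonneg summable_quaternary) simp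
  have "(\<lambda>n. (1/4) * (1/4) ^ n :: real) sums ((1/4) * (1 / (1 - 1/4)))"
    by (intro sums_mult geometric_sums) simp
  then have "(\<lambda>n. 1 / 4 ^ Suc n :: real) sums (1 / 3)" by (simp add: power_divide)
  then show "quaternary x \<le> 1 / 3"
    unfolding quaternary_def sums_iff
    by (metis (no_types, lifting) summable_quaternary suminf_le divide_right_mono of_bool_less_eq_one
        zero_le_numeral zero_le_power)
qed

lemma quaternary_Suc: "quaternary x = of_bool (x 0) / 4 + quaternary (\<lambda>n. x (Suc n)) / 4"
proof -
  have "quaternary x = (\<Sum>n. of_bool (x (Suc n)) / 4 ^ Suc (Suc n)) + of_bool (x 0) / 4"
    using suminf_split_head[OF summable_quaternary, of x] unfolding quaternary_def by simp
  also have "(\<lambda>n. of_bool (x (Suc n)) / 4 ^ Suc (Suc n) :: real) = (\<lambda>n. of_bool (x (Suc n)) / 4 ^ Suc n / 4)"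
    by (simp add: fun_eq_iff)
  also have "suminf \<dots> = quaternary (\<lambda>n. x (Suc n)) / 4"
    unfolding quaternary_def by (rule suminf_divide[OF summable_quaternary])
  finally show ?thesis by simp
qed

text \<open>At the first differing index \<open>j\<close> the digits contribute
  \<open>1 / 4 ^ Suc j\<close>, and the tails, each at most \<open>1 / 3\<close>, take back at most
  a third of it. What remains exceeds half of it, and \<open>j\<close> is at most
  \<open>i\<close>.\<close>

lemma quaternary_separates: "x i \<noteq> y i \<Longrightarrow> 1 / (2 * 4 ^ Suc i) \<le> \<bar>quaternary x - quaternary y\<bar>"
proof (induction i arbitrary: x y)
  case 0
  then show ?case
    using quaternary_bounds[of "\<lambda>n. x (Suc n)"] quaternary_bounds[of "\<lambda>n. y (Suc n)"]
    by (subst (1 2) quaternary_Suc) (auto simp: of_bool_def abs_if)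
next
  case (Suc i)
  show ?case
  proof (cases "x 0 = y 0")
    case True
    have "1 / (2 * 4 ^ Suc (Suc i)) \<le> \<bar>quaternary (\<lambda>n. x (Suc n)) - quaternary (\<lambda>n. y (Suc n))\<bar> / 4"
      using Suc.IH[of "\<lambda>n. x (Suc n)" "\<lambda>n. y (Suc n)"] Suc.prems by simp
    then show ?thesis using True by (subst (1 2) quaternary_Suc) (simp add: diff_divide_distrib[symmetric])
  next
    case False
    have "1 \<le> (4::real) ^ Suc i" by (rule one_le_power) simp
    then have "1 / (2 * 4 ^ Suc (Suc i)) \<le> (1 / 8 :: real)" by (simp add: divide_simps)
    also have "1 / 8 \<le> \<bar>quaternary x - quaternary y\<bar>"
      using quaternary_bounds[of "\<lambda>n. x (Suc n)"] quaternary_bounds[of "\<lambda>n. y (Suc n)"] False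
      by (subst (1 2) quaternary_Suc) (auto simp: of_bool_def abs_if)
    finally show ?thesis .
  qed
qed

text \<open>The digits of \<open>h y\<close> record which sets of a countable basis contain
  \<open>y\<close>. \<open>h\<close> need not be continuous; what matters is that distinct points
  have neighbourhoods whose codes stay a positive distance apart.\<close>

lemma separating_real_code:
  obtains h :: "'a::{t2_space, second_countable_topology} \<Rightarrow> real"
  where "\<And>y. 0 \<le> h y" "\<And>y. h y \<le> 1"
    "\<And>y y'. y \<noteq> y' \<Longrightarrow> \<exists>V V' d. open V \<and> open V' \<and> y \<in> V \<and> y' \<in> V' \<and> d > 0 \<and>
       (\<forall>a\<in>V. \<forall>b\<in>V'. d \<le> \<bar>h a - h b\<bar>)"
proof -
  obtain B :: "'a set set" where B: "countable B" "topological_basis B"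
    using ex_countable_basis by blast
  have "B \<noteq> {}" using B(2) unfolding topological_basis_def by (metis Sup_empty UNIV_not_empty open_UNIV subset_empty)
  define h where "h y = quaternary (\<lambda>n. y \<in> from_nat_into B n)" for y
  show ?thesis
  proof (rule that[of h])
    show "0 \<le> h y" "h y \<le> 1" for y
      using quaternary_bounds[of "\<lambda>n. y \<in> from_nat_into B n"] by (auto simp: h_def)
    fix y y' :: 'a assume "y \<noteq> y'"
    then obtain S S' where S: "open S" "open S'" "y \<in> S" "y' \<in> S'" "S \<inter> S' = {}"
      by (rule hausdorff[THEN exE]) blast
    obtain V where V: "V \<in> B" "y \<in> V" "V \<subseteq> S" using topological_basisE[OF B(2) S(1,3)] by blast
    obtain i where i: "from_nat_into B i = V" using from_nat_into_surj[OF B(1) V(1)] by blast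
    \<comment> \<open>Digit \<open>i\<close> tests membership in \<open>V\<close>; it is 1 on
      \<open>V\<close> and 0 on \<open>S'\<close>, which is disjoint from \<open>S\<close>.\<close>
    have "1 / (2 * 4 ^ Suc i) \<le> \<bar>h a - h b\<bar>" if "a \<in> V" "b \<in> S'" for a b
      unfolding h_def using that V(3) S(5) i by (intro quaternary_separates) auto
    then show "\<exists>V V' d. open V \<and> open V' \<and> y \<in> V \<and> y' \<in> V' \<and> d > 0 \<and>
       (\<forall>a\<in>V. \<forall>b\<in>V'. d \<le> \<bar>h a - h b\<bar>)"
      using V S topological_basis_open[OF B(2) V(1)]
      by (intro exI[of _ V] exI[of _ S'] exI[of _ "1 / (2 * 4 ^ Suc i)"]) auto
  qed
qed

section \<open>Transport to the real line and back\<close>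

text \<open>The image of a finitely additive \<open>\<Lambda>\<close> under \<open>h\<close> need
  not be countably additive. Rounding \<open>h\<close> down to multiples of \<open>1 / Suc n\<close>
  gives finitely many atoms, hence an honest probability measure \<open>N n\<close>, and a weak
  limit of these has the right integrals on bounded continuous functions.\<close>

lemma (in positive_functional) real_distribution_of_functional:
  fixes h :: "'a \<Rightarrow> real"
  assumes one: "\<Lambda> (\<lambda>_. 1) = 1" and h: "\<And>y. 0 \<le> h y" "\<And>y. h y \<le> 1"
  obtains \<nu> where "real_distribution \<nu>"
    "\<And>F B. (\<And>t. isCont F t) \<Longrightarrow> (\<And>t. \<bar>F t\<bar> \<le> B) \<Longrightarrow> integral\<^sup>L \<nu> F = \<Lambda> (\<lambda>y. F (h y))"
proof -
  \<comment> \<open>Cells run from 0 to \<open>Suc n\<close> inclusive, the last one being reached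
    when \<open>h y = 1\<close>.\<close>
  define cell where "cell n y = nat \<lfloor>real (Suc n) * h y\<rfloor>" for n y
  define w where "w n j = \<Lambda> (\<lambda>y. of_bool (cell n y = j))" for n j
  define N where "N n = distr (point_measure {..Suc n} (w n)) borel (\<lambda>j. real j / real (Suc n))" for n
  have bool: "(\<lambda>y. of_bool (P y) :: real) \<in> bdd_fun X" for P
    by (rule bdd_funI[of _ _ 1]) (simp add: of_bool_def)
  have w_nonneg: "0 \<le> w n j" for n j
    unfolding w_def by (intro nonneg bool) simp
  have cell_le: "cell n y \<le> Suc n" for n y
  proof -
    have "real (Suc n) * h y \<le> real (Suc n)" using h[of y] by (intro mult_left_le) auto
    then show ?thesis unfolding cell_def by linarith
  qed
  have sum_w: "(\<Sum>j\<le>Suc n. w n j * F j) = \<Lambda> (\<lambda>y. F (cell n y))" for n and F :: "nat \<Rightarrow> real"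
  proof -
    have bdd: "(\<lambda>y. F j * of_bool (cell n y = j)) \<in> bdd_fun X" for j by (intro bdd_fun_scale bool)
    have "(\<Sum>j\<le>Suc n. w n j * F j) = (\<Sum>j\<le>Suc n. \<Lambda> (\<lambda>y. F j * of_bool (cell n y = j)))"
      unfolding w_def by (simp add: scale[OF bool] mult.commute)
    also have "\<dots> = \<Lambda> (\<lambda>y. \<Sum>j\<le>Suc n. F j * of_bool (cell n y = j))"
      using sum[of "{..Suc n}" "\<lambda>j y. F j * of_bool (cell n y = j)"] bdd by simp
    also have "(\<lambda>y. \<Sum>j\<le>Suc n. F j * of_bool (cell n y = j)) = (\<lambda>y. F (cell n y))"
    proof
      fix y
      have "(\<Sum>j\<le>Suc n. F j * of_bool (cell n y = j)) = (\<Sum>j\<le>Suc n. if cell n y = j then F j else 0)"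
        by (intro sum.cong) auto
      also have "\<dots> = F (cell n y)" using cell_le[of n y] by (auto simp: sum.delta')
      finally show "(\<Sum>j\<le>Suc n. F j * of_bool (cell n y = j)) = F (cell n y)" .
    qed
    finally show ?thesis .
  qed
  have sum_w1: "(\<Sum>j\<le>Suc n. w n j) = 1" for n
    using sum_w[of n "\<lambda>_. 1"] one by simp
  have N_emeasure: "emeasure (N n) S = ennreal (\<Sum>j\<in>{j\<in>{..Suc n}. real j / real (Suc n) \<in> S}. w n j)"
    if "S \<in> sets borel" for n S
  proof -
    have "emeasure (N n) S = emeasure (point_measure {..Suc n} (w n))
        ((\<lambda>j. real j / real (Suc n)) -` S \<inter> {..Suc n})"
      using that unfolding N_def by (subst emeasure_distr) (auto simp: space_point_measure)
    also have "\<dots> = (\<Sum>j\<in>(\<lambda>j. real j / real (Suc n)) -` S \<inter> {..Suc n}. ennreal (w n j))"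
      by (subst emeasure_point_measure_finite) auto
    also have "\<dots> = ennreal (\<Sum>j\<in>(\<lambda>j. real j / real (Suc n)) -` S \<inter> {..Suc n}. w n j)"
      by (simp add: w_nonneg)
    finally show ?thesis
      by (simp add: vimage_def Int_def conj_commute)
  qed
  have N_dist: "real_distribution (N n)" for n
  proof -
    have "emeasure (N n) (space (N n)) = 1"
      using N_emeasure[of UNIV n] sum_w1[of n] by (simp add: N_def atMost_def)
    then interpret prob_space "N n" by (rule prob_spaceI)
    show ?thesis by standard (auto simp: N_def)
  qed
  have N_int: "integral\<^sup>L (N n) F = \<Lambda> (\<lambda>y. F (real (cell n y) / real (Suc n)))"
    if "F \<in> borel_measurable borel" for n and F :: "real \<Rightarrow> real"
  proof -
    have "integral\<^sup>L (N n) F = integral\<^sup>L (point_measure {..Suc n} (w n)) (\<lambda>j. F (real j / real (Suc n)))"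
      unfolding N_def using that by (intro integral_distr) auto
    also have "\<dots> = (\<Sum>j\<le>Suc n. w n j * F (real j / real (Suc n)))"
      by (subst lebesgue_integral_point_measure_finite) (auto simp: w_nonneg)
    finally show ?thesis by (simp only: sum_w)
  qed
  have "tight N"
    unfolding tight_def
  proof (intro conjI allI impI N_dist)
    fix e :: real assume "e > 0"
    \<comment> \<open>Tightness is phrased with half-open intervals; this one contains all atoms,
      which lie between 0 and 1.\<close>
    have "measure (N n) {-1<..2} = 1" for n
    proof -
      have "{j \<in> {..Suc n}. real j / real (Suc n) \<in> {-1<..2}} = {..Suc n}"
      proof -
        have "-1 < real j / real (Suc n) \<and> real j / real (Suc n) \<le> 2" if "j \<le> Suc n" for j
        proof -
          have "0 \<le> real j / real (Suc n)" "real j / real (Suc n) \<le> 1" using that by auto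
          then show ?thesis by linarith
        qed
        then show ?thesis by auto
      qed
      then show ?thesis using N_emeasure[of "{-1<..2}" n] sum_w1[of n] by (simp add: measure_def)
    qed
    then show "\<exists>a b. a < b \<and> (\<forall>n. 1 - e < measure (N n) {a<..b})"
      using \<open>e > 0\<close> by (intro exI[of _ "-1"] exI[of _ 2]) auto
  qed
  then obtain r \<nu> where r: "strict_mono r" "real_distribution \<nu>" "weak_conv_m (N \<circ> r) \<nu>"
    using tight_imp_convergent_subsubsequence[of N id] by (auto simp: strict_mono_id)
  show ?thesis
  proof (rule that[OF r(2)])
    fix F :: "real \<Rightarrow> real" and B assume F: "\<And>t. isCont F t" "\<And>t. \<bar>F t\<bar> \<le> B"
    have [measurable]: "F \<in> borel_measurable borel"
      using F(1) by (intro borel_measurable_continuous_onI) (simp add: continuous_at_imp_continuous_on)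
    have bF: "(\<lambda>y. F (k y)) \<in> bdd_fun X" for k :: "'a \<Rightarrow> real" by (rule bdd_funI[OF F(2)])
    have lim1: "(\<lambda>n. integral\<^sup>L ((N \<circ> r) n) F) \<longlonglongrightarrow> integral\<^sup>L \<nu> F"
      using r(2,3) N_dist F by (intro weak_conv_imp_integral_bdd_continuous_conv[of "N \<circ> r" \<nu> F B]) auto
    have "(\<lambda>n. integral\<^sup>L (N n) F) \<longlonglongrightarrow> \<Lambda> (\<lambda>y. F (h y))"
    proof (rule LIMSEQ_I)
      fix e :: real assume "e > 0"
      have "uniformly_continuous_on {0..1} F"
        using F(1) by (intro compact_uniformly_continuous) (auto simp: continuous_at_imp_continuous_on)
      then obtain d where d: "d > 0" "\<And>s t. s \<in> {0..1} \<Longrightarrow> t \<in> {0..1} \<Longrightarrow> \<bar>s - t\<bar> < d \<Longrightarrow> \<bar>F s - F t\<bar> < e / 2"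
        using \<open>e > 0\<close> unfolding uniformly_continuous_on_def dist_real_def
        by (metis half_gt_zero)
      obtain n0 where n0: "1 / real (Suc n0) < d" using d(1) nat_approx_posE by blast
      have "\<bar>integral\<^sup>L (N n) F - \<Lambda> (\<lambda>y. F (h y))\<bar> < e" if "n \<ge> n0" for n
      proof -
        have close: "\<bar>F (real (cell n y) / real (Suc n)) - F (h y)\<bar> \<le> e / 2" for y
        proof -
          have "0 \<le> real (Suc n) * h y" using h[of y] by simp
          then have c: "real (cell n y) \<le> real (Suc n) * h y" "real (Suc n) * h y < real (cell n y) + 1"
            unfolding cell_def by linarith+
          have "real (cell n y) / real (Suc n) \<le> h y" "h y < (real (cell n y) + 1) / real (Suc n)"
            using c by (simp_all add: field_simps)
          moreover have "1 / real (Suc n) \<le> 1 / real (Suc n0)" using that by (simp add: field_simps)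
          ultimately have "\<bar>real (cell n y) / real (Suc n) - h y\<bar> < d" 
            using n0 unfolding add_divide_distrib by linarith
          moreover have "real (cell n y) / real (Suc n) \<le> 1" using cell_le[of n y] by simp
          ultimately show ?thesis using h[of y] by (intro less_imp_le d(2)) auto
        qed
        have "\<bar>integral\<^sup>L (N n) F - \<Lambda> (\<lambda>y. F (h y))\<bar>
            = \<bar>\<Lambda> (\<lambda>y. F (real (cell n y) / real (Suc n)) - F (h y))\<bar>"
          by (subst diff[OF bF bF]) (simp add: N_int)
        also have "\<dots> \<le> e / 2 * \<Lambda> (\<lambda>_. 1)" using close by (rule abs_le)
        finally show ?thesis using \<open>e > 0\<close> one by simp
      qed
      then show "\<exists>n0. \<forall>n\<ge>n0. norm (integral\<^sup>L (N n) F - \<Lambda> (\<lambda>y. F (h y))) < e" by auto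
    qed
    from LIMSEQ_subseq_LIMSEQ[OF this r(1)]
    have "(\<lambda>n. integral\<^sup>L ((N \<circ> r) n) F) \<longlonglongrightarrow> \<Lambda> (\<lambda>y. F (h y))" by (simp add: o_def)
    with lim1 show "integral\<^sup>L \<nu> F = \<Lambda> (\<lambda>y. F (h y))" by (rule LIMSEQ_unique)
  qed
qed

text \<open>\<open>K\<close> carries no metric, so the functional is moved to the real line along a code \<open>h\<close>, represented
  there by Helly's theorem, and moved back along the inverse \<open>g\<close> of \<open>h\<close>, which extends continuously to
  the closure of \<open>h ` K\<close>.\<close>

theorem riesz_representation_compact:
  fixes K :: "'a::{t2_space, second_countable_topology} set"
  assumes K: "compact K" and \<Lambda>: "positive_functional K \<Lambda>" and one: "\<Lambda> (\<lambda>_. 1) = 1"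
  obtains \<mu> where "prob_space \<mu>" "sets \<mu> = sets (restrict_space borel K)"
    "\<And>\<phi> :: 'a \<Rightarrow> real. continuous_on K \<phi> \<Longrightarrow> integral\<^sup>L \<mu> \<phi> = \<Lambda> \<phi>"
proof -
  interpret positive_functional K \<Lambda> by (rule \<Lambda>)
  obtain h :: "'a \<Rightarrow> real" where h: "\<And>y. 0 \<le> h y" "\<And>y. h y \<le> 1"
    and sep: "\<And>y y'. y \<noteq> y' \<Longrightarrow> \<exists>V V' d. open V \<and> open V' \<and> y \<in> V \<and> y' \<in> V' \<and> d > 0 \<and>
       (\<forall>a\<in>V. \<forall>b\<in>V'. d \<le> \<bar>h a - h b\<bar>)"
    using separating_real_code by metis
  obtain \<nu> where \<nu>: "real_distribution \<nu>"
    and int: "\<And>F B. (\<And>t. isCont F t) \<Longrightarrow> (\<And>t. \<bar>F t\<bar> \<le> B) \<Longrightarrow> integral\<^sup>L \<nu> F = \<Lambda> (\<lambda>y. F (h y))"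
    by (rule real_distribution_of_functional[OF one, of h, OF h]) blast
  interpret \<nu>: real_distribution \<nu> by (rule \<nu>)
  \<comment> \<open>\<open>R\<close> is the closure of the set of pairs \<open>(h a, a)\<close> with
    \<open>a\<close> in \<open>K\<close>, that is, of the graph of the inverse of \<open>h\<close>.
    The separation property keeps it single-valued, and compactness of \<open>K\<close> makes its
    domain \<open>C\<close> closed and the resulting function \<open>g\<close> continuous.\<close>
  define R where "R t y \<longleftrightarrow> y \<in> K \<and> (\<forall>d>0. \<forall>V. open V \<and> y \<in> V \<longrightarrow> (\<exists>a\<in>K \<inter> V. \<bar>h a - t\<bar> < d))" for t y
  define C where "C = {t. \<exists>y. R t y}"
  define g where "g t = (SOME y. R t y)" for t
  have R_h: "R (h y) y" if "y \<in> K" for y using that by (auto simp: R_def intro!: bexI[of _ y])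
  have R_g: "R t (g t)" if "t \<in> C" for t
    using that unfolding C_def g_def by (auto intro: someI)
  have RD: "\<exists>a\<in>K \<inter> V. \<bar>h a - t\<bar> < d" if "R t y" "open V" "y \<in> V" "d > 0" for t y V d
    using that by (simp add: R_def)
  have R_unique: "y = y'" if R: "R t y" "R t y'" for t y y'
  proof (rule ccontr)
    assume "y \<noteq> y'"
    then obtain V V' d where V: "open V" "open V'" "y \<in> V" "y' \<in> V'" "d > 0"
      "\<forall>a\<in>V. \<forall>b\<in>V'. d \<le> \<bar>h a - h b\<bar>" using sep[of y y'] by blast
    obtain a where "a \<in> V" "\<bar>h a - t\<bar> < d / 2" using RD[OF R(1) V(1,3), of "d / 2"] V(5) by auto
    moreover obtain b where "b \<in> V'" "\<bar>h b - t\<bar> < d / 2" using RD[OF R(2) V(2,4), of "d / 2"] V(5) by auto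
    ultimately show False using V(6)[rule_format, of a b] by linarith
  qed
  have g_h: "g (h y) = y" if "y \<in> K" for y
    using R_unique[OF R_g R_h[OF that]] R_h[OF that] by (auto simp: C_def)
  \<comment> \<open>A tube argument: if the fibre of \<open>R\<close> over \<open>t\<close> misses
    the compact set \<open>L\<close>, so do the fibres over nearby \<open>t'\<close>. With
    \<open>L = K\<close> it shows that \<open>C\<close> is closed, with \<open>L = K - B\<close>
    that \<open>g\<close> is continuous.\<close>
  have R_open: "\<exists>d>0. \<forall>t'. \<bar>t' - t\<bar> < d \<longrightarrow> (\<forall>y\<in>L. \<not> R t' y)"
    if L: "compact L" "L \<subseteq> K" "\<And>y. y \<in> L \<Longrightarrow> \<not> R t y" for L t
  proof -
    have "\<forall>y\<in>L. \<exists>V d. open V \<and> y \<in> V \<and> d > 0 \<and> (\<forall>a\<in>K \<inter> V. d \<le> \<bar>h a - t\<bar>)"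
    proof
      fix y assume y: "y \<in> L"
      then have "y \<in> K" "\<not> R t y" using L(2,3) by auto
      then show "\<exists>V d. open V \<and> y \<in> V \<and> d > 0 \<and> (\<forall>a\<in>K \<inter> V. d \<le> \<bar>h a - t\<bar>)"
        unfolding R_def not_le[symmetric] by blast
    qed
    then obtain V d where V: "\<And>y. y \<in> L \<Longrightarrow> open (V y)" "\<And>y. y \<in> L \<Longrightarrow> y \<in> V y"
      "\<And>y. y \<in> L \<Longrightarrow> d y > 0" "\<And>y a. y \<in> L \<Longrightarrow> a \<in> K \<inter> V y \<Longrightarrow> d y \<le> \<bar>h a - t\<bar>"
      by metis
    have "\<exists>I\<subseteq>L. finite I \<and> L \<subseteq> (\<Union>y\<in>I. V y)"
    proof (rule compactE_image[OF L(1), where C = L and f = V])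
      show "open (V y)" if "y \<in> L" for y using V(1)[OF that] .
      show "L \<subseteq> (\<Union>y\<in>L. V y)" using V(2) by blast
    qed blast
    then obtain I where I: "I \<subseteq> L" "finite I" "L \<subseteq> (\<Union>y\<in>I. V y)" by blast
    \<comment> \<open>Half of the smallest distance, because two errors below \<open>e\<close> are
      added: from \<open>h a\<close> to \<open>t'\<close> and from \<open>t'\<close> to
      \<open>t\<close>. The element 1 covers empty \<open>I\<close>.\<close>
    define e where "e = Min (insert 1 (d ` I)) / 2"
    have "0 < Min (insert 1 (d ` I))" 
    proof (subst Min_gr_iff)
      show "\<forall>a\<in>insert 1 (d ` I). 0 < a"
      proof
        fix a assume "a \<in> insert 1 (d ` I)"
        then consider "a = 1" | y where "y \<in> I" "a = d y" by blast
        then show "0 < a" using V(3)[OF subsetD[OF I(1)]] by cases simp_all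
      qed
    qed (simp_all add: I(2))
    then have e: "e > 0" by (simp add: e_def)
    have e_le: "2 * e \<le> d y" if "y \<in> I" for y
    proof -
      have "Min (insert 1 (d ` I)) \<le> d y" by (rule Min_le) (simp_all add: I(2) that)
      then show ?thesis by (simp add: e_def)
    qed
    have "\<not> R t' y'" if near: "\<bar>t' - t\<bar> < e" and y': "y' \<in> L" for t' y'
    proof
      assume "R t' y'"
      obtain y where y: "y \<in> I" "y' \<in> V y" using I(3) y' by auto
      then obtain a where "a \<in> K \<inter> V y" "\<bar>h a - t'\<bar> < e"
        using RD[OF \<open>R t' y'\<close> V(1)[of y], of e] I(1) e y by auto
      moreover have "d y \<le> \<bar>h a - t\<bar>" using V(4)[of y a] I(1) y(1) \<open>a \<in> K \<inter> V y\<close> by blast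
      ultimately show False using e_le[OF y(1)] near by linarith
    qed
    then show ?thesis using e by blast
  qed
  have "open (- C)"
    unfolding open_dist
  proof
    fix t assume "t \<in> - C"
    then obtain d where "d > 0" "\<And>t' y. \<bar>t' - t\<bar> < d \<Longrightarrow> y \<in> K \<Longrightarrow> \<not> R t' y"
      using R_open[OF K order_refl, of t] by (auto simp: C_def)
    then show "\<exists>e>0. \<forall>y. dist y t < e \<longrightarrow> y \<in> - C"
      unfolding C_def R_def dist_real_def by blast
  qed
  then have C: "closed C" by (simp add: closed_def)
  have hC: "h y \<in> C" if "y \<in> K" for y using R_h[OF that] by (auto simp: C_def)
  have "K \<noteq> {}"
  proof
    assume "K = {}"
    then have "\<Lambda> (\<lambda>_. 1) = \<Lambda> (\<lambda>_. 0)" by (intro cong) auto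
    then show False using one zero by simp
  qed
  then have "C \<noteq> {}" using hC by blast
  have gK: "g t \<in> K" if "t \<in> C" for t using R_g[OF that] by (simp add: R_def)
  have g_cont: "continuous_on C g"
    unfolding continuous_on_topological
  proof (intro ballI allI impI)
    fix t B assume t: "t \<in> C" "open B" "g t \<in> B"
    have "compact (K - B)" using K t(2) by (rule compact_diff)
    then obtain d where d: "d > 0" "\<And>t' y. \<bar>t' - t\<bar> < d \<Longrightarrow> y \<in> K - B \<Longrightarrow> \<not> R t' y"
      using R_open[of "K - B" t] R_unique[OF R_g[OF t(1)]] t(3) by blast
    then show "\<exists>A. open A \<and> t \<in> A \<and> (\<forall>t'\<in>C. t' \<in> A \<longrightarrow> g t' \<in> B)"
      using R_g gK by (intro exI[of _ "ball t d"]) (auto simp: dist_real_def abs_minus_commute)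
  qed
  \<comment> \<open>The truncated distance to \<open>C\<close> is a bounded continuous function
    vanishing at every code \<open>h y\<close> of a point of \<open>K\<close>. Its integral is
    therefore 0, so \<open>\<nu>\<close> is concentrated on \<open>C\<close>, where \<open>g\<close>
    is available.\<close>
  have "integral\<^sup>L \<nu> (\<lambda>t. min 1 (infdist t C)) = \<Lambda> (\<lambda>y. min 1 (infdist (h y) C))"
    by (rule int[where B = 1]) (auto intro!: continuous_intros simp: infdist_nonneg abs_le_iff)
  also have "\<dots> = \<Lambda> (\<lambda>_. 0)"
    using hC by (intro cong[symmetric]) auto
  finally have int0: "integral\<^sup>L \<nu> (\<lambda>t. min 1 (infdist t C)) = 0" by (simp add: zero)
  have [measurable]: "(\<lambda>t. min 1 (infdist t C)) \<in> borel_measurable borel"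
    by (intro borel_measurable_continuous_onI continuous_intros)
  have "integrable \<nu> (\<lambda>t. min 1 (infdist t C))"
    by (rule \<nu>.integrable_const_bound[where B = 1]) (auto simp: infdist_nonneg)
  then have "AE t in \<nu>. min 1 (infdist t C) = 0"
    using int0 by (subst (asm) integral_nonneg_eq_0_iff_AE) (auto simp: infdist_nonneg)
  then have AE: "AE t in \<nu>. t \<in> C"
    by eventually_elim (use in_closed_iff_infdist_zero[OF C \<open>C \<noteq> {}\<close>] in \<open>auto simp: min_def split: if_splits\<close>)
  have C_sets [measurable, simp]: "C \<in> sets borel" using C by (rule borel_closed)
  have "emeasure \<nu> C = 1" using AE by (intro \<nu>.emeasure_eq_1_AE) auto
  then interpret \<nu>C: prob_space "restrict_space \<nu> C"
    by (intro prob_space_restrict_space) auto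
  have sets_C: "sets (restrict_space \<nu> C) = sets (restrict_space borel C)"
    by (intro sets_restrict_space_cong) simp
  have g_meas: "g \<in> measurable (restrict_space \<nu> C) (restrict_space borel K)"
    unfolding measurable_cong_sets[OF sets_C refl]
    using gK by (intro measurable_restrict_space2 borel_measurable_continuous_on_restrict g_cont)
      (auto simp: space_restrict_space)
  define \<mu> where "\<mu> = distr (restrict_space \<nu> C) (restrict_space borel K) g"
  show ?thesis
  proof (rule that[of \<mu>])
    show "prob_space \<mu>" unfolding \<mu>_def by (rule \<nu>C.prob_space_distr[OF g_meas])
    show "sets \<mu> = sets (restrict_space borel K)" by (simp add: \<mu>_def)
    fix \<phi> :: "'a \<Rightarrow> real" assume \<phi>: "continuous_on K \<phi>"
    have "continuous_on C (\<lambda>t. \<phi> (g t))"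
      using g_cont gK by (intro continuous_on_compose2[OF \<phi>]) auto
    moreover obtain b where b: "b \<ge> 0" "\<And>y. y \<in> K \<Longrightarrow> \<bar>\<phi> y\<bar> \<le> b"
      using compact_imp_bounded[OF compact_continuous_image[OF \<phi> K]] \<open>K \<noteq> {}\<close>
      unfolding bounded_iff by (metis abs_ge_zero imageI all_not_in_conv order_trans real_norm_def)
    \<comment> \<open>The integral formula for \<open>\<nu>\<close> is known for bounded continuous
      functions on the whole line only, so \<open>\<phi> \<circ> g\<close> is extended from
      \<open>C\<close> by Tietze's theorem with the same bound.\<close>
    ultimately obtain F where F: "continuous_on UNIV F" "\<And>t. t \<in> C \<Longrightarrow> F t = \<phi> (g t)" "\<And>t. \<bar>F t\<bar> \<le> b"
      using Tietze[of C "\<lambda>t. \<phi> (g t)" UNIV b] C gK by (metis closed_closedin subtopology_UNIV UNIV_I real_norm_def)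
    have [measurable]: "F \<in> borel_measurable borel"
      using F(1) by (rule borel_measurable_continuous_onI)
    have "integral\<^sup>L \<mu> \<phi> = integral\<^sup>L (restrict_space \<nu> C) (\<lambda>t. \<phi> (g t))"
      unfolding \<mu>_def by (intro integral_distr g_meas borel_measurable_continuous_on_restrict \<phi>)
    also have "\<dots> = integral\<^sup>L (restrict_space \<nu> C) F"
      by (intro Bochner_Integration.integral_cong refl) (simp add: F(2) space_restrict_space)
    also have "\<dots> = integral\<^sup>L \<nu> (\<lambda>t. indicator C t *\<^sub>R F t)"
      by (subst integral_restrict_space) auto
    also have "\<dots> = integral\<^sup>L \<nu> F"
      using AE by (intro integral_cong_AE) (auto elim!: eventually_mono)
    also have "\<dots> = \<Lambda> (\<lambda>y. F (h y))"
      using F(1,3) by (intro int[where B = b]) (simp_all add: continuous_on_eq_continuous_at)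
    also have "\<dots> = \<Lambda> \<phi>"
      using F(2,3) hC g_h b(2) by (intro cong bdd_funI[where b = b]) auto
    finally show "integral\<^sup>L \<mu> \<phi> = \<Lambda> \<phi>" .
  qed
qed

section \<open>Levi forms on the manifold\<close>

lemma Ck_on_subset:
  assumes "Ck_on n S f" "T \<subseteq> S"
  shows "Ck_on n T f"
  using assms unfolding Ck_on_def by (meson continuous_on_subset subsetD)

lemma atlasD:
  assumes "complex_atlas A" "c \<in> A"
  shows "open (fst c)" "open (chart_image c)" "continuous_on (fst c) (snd c)"
    "continuous_on (chart_image c) (chart_inv c)"
    "z \<in> fst c \<Longrightarrow> chart_inv c (snd c z) = z" "z \<in> fst c \<Longrightarrow> snd c z \<in> chart_image c"
    "p \<in> chart_image c \<Longrightarrow> chart_inv c p \<in> fst c" "p \<in> chart_image c \<Longrightarrow> snd c (chart_inv c p) = p"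
proof -
  have "open (fst c) \<and> open (chart_image c) \<and> homeomorphism (fst c) (chart_image c) (snd c) (chart_inv c)"
    using assms unfolding complex_atlas_def by blast
  then show "open (fst c)" "open (chart_image c)" "continuous_on (fst c) (snd c)"
    "continuous_on (chart_image c) (chart_inv c)"
    "z \<in> fst c \<Longrightarrow> chart_inv c (snd c z) = z" "z \<in> fst c \<Longrightarrow> snd c z \<in> chart_image c"
    "p \<in> chart_image c \<Longrightarrow> chart_inv c p \<in> fst c" "p \<in> chart_image c \<Longrightarrow> snd c (chart_inv c p) = p"
    unfolding homeomorphism_def by auto
qed

lemma charts_at_nonempty:
  assumes "complex_atlas A"
  obtains c where "c \<in> charts_at A z"
proof -
  have "z \<in> (\<Union>c\<in>A. fst c)" using assms by (simp add: complex_atlas_def)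
  then show ?thesis using that by (auto simp: charts_at_def)
qed

lemma chart_preimage_open:
  assumes "complex_atlas A" "c \<in> A" "open S"
  shows "open {y \<in> fst c. snd c y \<in> S}"
  using continuous_open_preimage[OF atlasD(3,1)[OF assms(1,2)] assms(3)]
  by (auto simp: vimage_def Int_def)

lemma Ck_manifoldD: "Ck_manifold A n u \<Longrightarrow> c \<in> A \<Longrightarrow> Ck_on n (chart_image c) (u \<circ> chart_inv c)"
  by (simp add: Ck_manifold_def)

lemma Ck_manifold_continuous:
  assumes A: "complex_atlas A" and u: "Ck_manifold A n u"
  shows "continuous_on S u"
proof -
  have "continuous_on (fst c) u" if c: "c \<in> A" for c
  proof -
    have "continuous_on (chart_image c) (u \<circ> chart_inv c)"
      using Ck_onD(1)[OF Ck_manifoldD[OF u c], of "[]"] by simp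
    then have "continuous_on (fst c) (\<lambda>z. (u \<circ> chart_inv c) (snd c z))"
      by (rule continuous_on_compose2[OF _ atlasD(3)[OF A c]]) (auto simp: chart_image_def)
    then show ?thesis
      by (rule continuous_on_eq) (simp add: atlasD[OF A c])
  qed
  then have "continuous_on (\<Union>c\<in>A. fst c) u"
    using atlasD(1)[OF A] by (intro continuous_on_open_UN)
  then show ?thesis using A unfolding complex_atlas_def by (metis continuous_on_subset subset_UNIV)
qed

lemma Ck_manifold_bounded_linear:
  assumes "bounded_linear L" "complex_atlas A" "Ck_manifold A n u"
  shows "Ck_manifold A n (\<lambda>z. L (u z))"
  using Ck_on_bounded_linear[OF assms(1) atlasD(2)[OF assms(2)] Ck_manifoldD[OF assms(3)]]
  by (simp add: Ck_manifold_def o_def)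

lemma Ck_manifold_add:
  assumes "complex_atlas A" "Ck_manifold A n u" "Ck_manifold A n w"
  shows "Ck_manifold A n (\<lambda>z. u z + w z)"
  using Ck_on_add[OF atlasD(2)[OF assms(1)] Ck_manifoldD[OF assms(2)] Ck_manifoldD[OF assms(3)]]
  by (simp add: Ck_manifold_def o_def)

lemma Ck_manifold_scale:
  fixes u :: "'m::{t2_space, second_countable_topology} \<Rightarrow> real"
  assumes "complex_atlas A" "Ck_manifold A n u"
  shows "Ck_manifold A n (\<lambda>z. a * u z)"
  by (rule Ck_manifold_bounded_linear[OF bounded_linear_mult_right assms])

lemma Ck_manifold_const: "Ck_manifold A n (\<lambda>_. a)"
  by (simp add: Ck_manifold_def o_def Ck_on_const)

lemmas Ck_manifold_intros = Ck_manifold_add Ck_manifold_scale Ck_manifold_const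

section \<open>The Levi form in a chart and its minimum principle\<close>

text \<open>A quarter of the Laplacian of \<open>u\<close> along the complex line through
  \<open>z\<close> with direction \<open>v\<close> in the coordinates of \<open>c\<close>.\<close>

definition levi_form :: "('m, 'k::finite) chart \<Rightarrow> ('m \<Rightarrow> real) \<Rightarrow> complex ^ 'k \<Rightarrow> 'm \<Rightarrow> real" where
  "levi_form c u v z = (iter_deriv [v, v] (u \<circ> chart_inv c) (snd c z)
     + iter_deriv [\<i> *s v, \<i> *s v] (u \<circ> chart_inv c) (snd c z)) / 4"

lemma levi_form_add:
  assumes A: "complex_atlas A" and c: "c \<in> A" and z: "z \<in> fst c"
    and u: "Ck_manifold A 2 u" and w: "Ck_manifold A 2 w"
  shows "levi_form c (\<lambda>z. u z + w z) v z = levi_form c u v z + levi_form c w v z"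
  using iter_deriv_add[OF atlasD(2)[OF A c] Ck_manifoldD[OF u c] Ck_manifoldD[OF w c], of _ "snd c z"]
    atlasD(6)[OF A c z]
  by (simp add: levi_form_def o_def add_divide_distrib)

lemma levi_form_scale:
  assumes A: "complex_atlas A" and c: "c \<in> A" and z: "z \<in> fst c" and u: "Ck_manifold A 2 u"
  shows "levi_form c (\<lambda>z. a * u z) v z = a * levi_form c u v z"
  using iter_deriv_bounded_linear[OF bounded_linear_mult_right atlasD(2)[OF A c] Ck_manifoldD[OF u c],
      of _ "snd c z" a] atlasD(6)[OF A c z]
  by (simp add: levi_form_def o_def algebra_simps)

lemma levi_form_const: "levi_form c (\<lambda>_. a) v z = 0"
  by (simp add: levi_form_def o_def iter_deriv_const)

lemma continuous_on_levi_form: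
  assumes A: "complex_atlas A" and c: "c \<in> A" and u: "Ck_manifold A 2 u"
  shows "continuous_on (chart_image c) (\<lambda>p. levi_form c u v (chart_inv c p))"
proof -
  have "continuous_on (chart_image c) (\<lambda>p. (iter_deriv [v, v] (u \<circ> chart_inv c) p
     + iter_deriv [\<i> *s v, \<i> *s v] (u \<circ> chart_inv c) p) / 4)"
    by (intro continuous_intros Ck_onD(1)[OF Ck_manifoldD[OF u c]]) auto
  then show ?thesis
    by (rule continuous_on_eq) (simp add: levi_form_def atlasD[OF A c])
qed

text \<open>Both real directions \<open>v\<close> and \<open>\<i> *s v\<close> see a local minimum,
  so both second derivatives in the sum are nonnegative.\<close>

lemma levi_form_local_min:
  assumes A: "complex_atlas A" and c: "c \<in> A" and z: "z \<in> fst c" and u: "Ck_manifold A 2 u"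
    and W: "open W" "z \<in> W" "\<And>y. y \<in> W \<Longrightarrow> u z \<le> u y"
  shows "0 \<le> levi_form c u v z"
proof -
  let ?S = "chart_image c \<inter> chart_inv c -` W" and ?f = "u \<circ> chart_inv c"
  have S: "open ?S" by (rule continuous_open_preimage[OF atlasD(4,2)[OF A c] W(1)])
  have z': "snd c z \<in> ?S" using z W(2) by (simp add: atlasD[OF A c])
  have f: "Ck_on 2 ?S ?f" by (rule Ck_on_subset[OF Ck_manifoldD[OF u c]]) auto
  have "?f (snd c z) \<le> ?f p" if "p \<in> ?S" for p
    using that W(3) z by (simp add: atlasD[OF A c])
  then have "0 \<le> iter_deriv [w, w] ?f (snd c z)" for w
    by (rule local_min_iter_deriv_nonneg[OF S f z'])
  then show ?thesis unfolding levi_form_def by simp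
qed

text \<open>Symmetry of second derivatives, applied to real and imaginary parts, removes the mixed
  terms of \<open>sesq_levi_matrix\<close>.\<close>

lemma sesq_i_ddbar:
  fixes u :: "'m::{t2_space, second_countable_topology} \<Rightarrow> complex"
  assumes A: "complex_atlas A" and c: "c \<in> charts_at A z" and u: "Ck_manifold A 2 u"
  shows "sesq (i_ddbar A u c z) v v =
    Complex (levi_form c (\<lambda>z. Re (u z)) v z) (levi_form c (\<lambda>z. Im (u z)) v z)"
proof -
  let ?f = "u \<circ> chart_inv c" and ?p = "snd c z"
  have c': "c \<in> A" "z \<in> fst c" using c by (auto simp: charts_at_def)
  note S = atlasD(2)[OF A c'(1)] and p = atlasD(6)[OF A c'] and f = Ck_manifoldD[OF u c'(1)]
  have Re: "iter_deriv [a, b] (\<lambda>q. Re (?f q)) ?p = Re (iter_deriv [a, b] ?f ?p)" for a b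
    using iter_deriv_bounded_linear[OF bounded_linear_Re S f _ p] by simp
  have Im: "iter_deriv [a, b] (\<lambda>q. Im (?f q)) ?p = Im (iter_deriv [a, b] ?f ?p)" for a b
    using iter_deriv_bounded_linear[OF bounded_linear_Im S f _ p] by simp
  have comm: "iter_deriv [a, b] ?f ?p = iter_deriv [b, a] ?f ?p" for a b
    using iter_deriv_commute[OF S Ck_on_bounded_linear[OF bounded_linear_Re S f] p, of a b]
      iter_deriv_commute[OF S Ck_on_bounded_linear[OF bounded_linear_Im S f] p, of a b]
    unfolding Re Im by (simp add: complex_eq_iff)
  have "i_ddbar A u c z = levi_matrix ?f ?p"
    using c by (simp add: i_ddbar_def levi_matrix_def)
  then have "sesq (i_ddbar A u c z) v v = (iter_deriv [v, v] ?f ?p + iter_deriv [\<i> *s v, \<i> *s v] ?f ?p) / 4"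
    using sesq_levi_matrix[OF S f p, of v] comm[of v "\<i> *s v"] by simp
  then show ?thesis
    using Re[of v v] Re[of "\<i> *s v" "\<i> *s v"] Im[of v v] Im[of "\<i> *s v" "\<i> *s v"]
    by (simp add: levi_form_def o_def complex_eq_iff)
qed

lemma sesq_i_ddbar_real:
  fixes u :: "'m::{t2_space, second_countable_topology} \<Rightarrow> real"
  assumes A: "complex_atlas A" and c: "c \<in> charts_at A z" and u: "Ck_manifold A 2 u"
  shows "sesq (i_ddbar A (\<lambda>y. complex_of_real (u y)) c z) v v = of_real (levi_form c u v z)"
  using sesq_i_ddbar[OF A c Ck_manifold_bounded_linear[OF bounded_linear_of_real A u]]
  by (simp add: levi_form_const complex_eq_iff)

text \<open>At an interior minimum of \<open>\<phi> - e \<rho>\<close> the Levi form would be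
  negative in the given direction. The direction may vary arbitrarily with the point, so the
  principle serves both the hull, with vectors of \<open>\<Gamma>\<close>, and the current, with
  selected vectors.\<close>

lemma levi_minimum_principle:
  assumes A: "complex_atlas A" and \<rho>: "Ck_manifold A 2 \<rho>" and \<phi>: "Ck_manifold A 2 \<phi>"
    and U: "open U" "compact (closure U)"
    and dir: "\<And>z. z \<in> U \<Longrightarrow> \<exists>c\<in>charts_at A z. \<exists>v. 0 < levi_form c \<rho> v z \<and> levi_form c \<phi> v z \<le> 0"
    and bdry: "\<And>z. z \<in> frontier U \<Longrightarrow> 0 \<le> \<phi> z"
    and x: "x \<in> U"
  shows "0 \<le> \<phi> x"
proof (rule ccontr)
  assume neg: "\<not> 0 \<le> \<phi> x"
  have ne: "closure U \<noteq> {}" using x closure_subset by blast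
  obtain C where C: "C > 0" "\<And>z. z \<in> closure U \<Longrightarrow> \<bar>\<rho> z\<bar> \<le> C"
    using compact_imp_bounded[OF compact_continuous_image[OF Ck_manifold_continuous[OF A \<rho>] U(2)]]
    unfolding bounded_pos by auto
  \<comment> \<open>Subtracting \<open>e * \<rho>\<close> moves each value by at most
    \<open>e * C\<close>, so \<open>2 * e * C < - \<phi> x\<close> prevents the minimum from moving
    to the boundary.\<close>
  define e where "e = - \<phi> x / (2 * C + 1)"
  have e: "e > 0" "2 * (e * C) < - \<phi> x"
    using neg C(1) by (auto simp: e_def field_simps)
  define \<psi> where "\<psi> z = \<phi> z + (- e) * \<rho> z" for z
  have \<psi>: "Ck_manifold A 2 \<psi>"
    unfolding \<psi>_def by (intro Ck_manifold_intros A \<rho> \<phi>)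
  obtain z where z: "z \<in> closure U" "\<And>y. y \<in> closure U \<Longrightarrow> \<psi> z \<le> \<psi> y"
    using continuous_attains_inf[OF U(2) ne Ck_manifold_continuous[OF A \<psi>]] by blast
  have e_rho: "\<bar>e * \<rho> y\<bar> \<le> e * C" if "y \<in> closure U" for y
    using C(2)[OF that] e(1) by (simp add: abs_mult)
  have "z \<in> U"
  proof (rule ccontr)
    assume "z \<notin> U"
    then have "z \<in> frontier U" using z(1) U(1) by (simp add: frontier_def interior_open)
    then have "- (e * C) \<le> \<psi> z" using bdry[of z] e_rho[OF z(1)] unfolding \<psi>_def by linarith
    moreover have "\<psi> x \<le> \<phi> x + e * C" using e_rho[of x] x closure_subset unfolding \<psi>_def by fastforce
    moreover have "\<psi> z \<le> \<psi> x" using z(2) x closure_subset by blast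
    ultimately show False using e(2) by linarith
  qed
  then obtain c v where c: "c \<in> charts_at A z" "0 < levi_form c \<rho> v z" "levi_form c \<phi> v z \<le> 0"
    using dir by blast
  then have c': "c \<in> A" "z \<in> fst c" by (auto simp: charts_at_def)
  have "0 \<le> levi_form c \<psi> v z"
    by (rule levi_form_local_min[OF A c' \<psi> U(1) \<open>z \<in> U\<close>]) (use z(2) closure_subset in blast)
  also have "levi_form c \<psi> v z = levi_form c \<phi> v z + (- e) * levi_form c \<rho> v z"
    unfolding \<psi>_def levi_form_add[OF A c' \<phi> Ck_manifold_scale[OF A \<rho>]] levi_form_scale[OF A c' \<rho>] ..
  also have "\<dots> < 0" using c(3) mult_pos_pos[OF e(1) c(2)] by simp
  finally show False by simp
qed

section \<open>Test forms\<close>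

text \<open>The chain rule for
  \<open>transition c d' = transition d d' \<circ> transition c d\<close> near the point. It lets
  positivity of a form, stated for tangent vectors, be tested on a component vector in a single
  chart.\<close>

lemma chart_vec_tangent10:
  assumes A: "complex_atlas A" and c: "c \<in> charts_at A z"
  shows "chart_vec A c z v \<in> tangent10 A z" "chart_vec A c z v c = v"
proof -
  have deriv: "(transition d d' has_derivative frechet_derivative (transition d d') (at (snd d z))) (at (snd d z))"
    if "d \<in> charts_at A z" "d' \<in> charts_at A z" for d d'
  proof -
    have "holomorphic_map_on (snd d ` (fst d \<inter> fst d')) (transition d d')"
      using A that by (auto simp: complex_atlas_def charts_at_def)
    then have "transition d d' differentiable (at (snd d z))"
      using that unfolding holomorphic_map_on_def differentiable_def charts_at_def by blast
    then show ?thesis by (simp add: frechet_derivative_works)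
  qed
  have c': "c \<in> A" "z \<in> fst c" using c by (auto simp: charts_at_def)
  have "frechet_derivative (transition c c) (at (snd c z)) = frechet_derivative (\<lambda>p. p) (at (snd c z))"
    by (rule frechet_derivative_cong_open[OF atlasD(2)[OF A c'(1)] atlasD(6)[OF A c']])
       (simp add: transition_def atlasD[OF A c'(1)])
  then show "chart_vec A c z v c = v" using c by (simp add: chart_vec_def)
  have eq: "chart_vec A c z v d' = frechet_derivative (transition d d') (at (snd d z)) (chart_vec A c z v d)"
    if d: "d \<in> charts_at A z" "d' \<in> charts_at A z" for d d'
  proof -
    have d': "d \<in> A" "z \<in> fst d" using d by (auto simp: charts_at_def)
    let ?S = "chart_image c \<inter> chart_inv c -` fst d"
    have S: "open ?S" by (rule continuous_open_preimage[OF atlasD(4,2)[OF A c'(1)] atlasD(1)[OF A d'(1)]])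
    have z: "snd c z \<in> ?S" using c' d' by (simp add: atlasD[OF A c'(1)])
    have "transition c d (snd c z) = snd d z" using c' by (simp add: transition_def atlasD[OF A c'(1)])
    then have "((transition d d' \<circ> transition c d) has_derivative
        (frechet_derivative (transition d d') (at (snd d z)) \<circ> frechet_derivative (transition c d) (at (snd c z))))
        (at (snd c z))"
      using deriv[OF c d(1)] deriv[OF d] by (intro diff_chain_at) auto
    then have "(transition c d' has_derivative
        (frechet_derivative (transition d d') (at (snd d z)) \<circ> frechet_derivative (transition c d) (at (snd c z))))
        (at (snd c z))"
      by (rule has_derivative_transform_within_open[OF _ S z])
         (simp add: transition_def atlasD[OF A d'(1)])
    from fun_cong[OF frechet_derivative_at[OF this], of v] show ?thesis
      using d by (simp add: chart_vec_def)
  qed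
  show "chart_vec A c z v \<in> tangent10 A z"
    unfolding tangent10_def
  proof (intro CollectI conjI ballI allI impI)
    fix d assume "d \<notin> charts_at A z"
    then show "chart_vec A c z v d = 0" by (simp add: chart_vec_def)
  qed (rule eq)
qed

lemma sesq_add: "sesq (h + h') v w = sesq h v w + sesq h' v w"
  by (simp add: sesq_def distrib_right sum.distrib)

lemma sesq_scale: "sesq (\<chi> j l. a * h $ j $ l) v w = a * sesq h v w"
  by (simp add: sesq_def sum_distrib_left mult.assoc)

lemma norm_sesq_le:
  assumes "\<And>j l. norm (h $ j $ l) \<le> e"
  shows "norm (sesq h v v) \<le> e * (\<Sum>j\<in>UNIV. \<Sum>l\<in>UNIV. norm (v $ j) * norm (v $ l))"
proof -
  have "norm (sesq h v v) \<le> (\<Sum>j\<in>UNIV. \<Sum>l\<in>UNIV. e * (norm (v $ j) * norm (v $ l)))"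
    unfolding sesq_def
    by (intro sum_norm_le) (simp add: norm_mult mult.assoc mult_right_mono assms)
  then show ?thesis by (simp add: sum_distrib_left)
qed

lemma continuous_on_sesq_test_form:
  assumes "\<omega> \<in> test_forms11 A" "c \<in> A"
  shows "continuous_on (chart_image c) (\<lambda>p. sesq (\<omega> c (chart_inv c p)) v v)"
proof -
  have "continuous_on (chart_image c) (form_coeff \<omega> c j l)" for j l
    using assms Ck_onD(1)[of 0 "chart_image c" "form_coeff \<omega> c j l" "[]"] by (simp add: test_forms11_def)
  then show ?thesis
    unfolding sesq_def form_coeff_def
    by (intro continuous_on_sum continuous_on_mult continuous_on_const)
qed

section \<open>Hulls and currents\<close>

text \<open>The minimum principle is applied to \<open>r - u\<close>, with \<open>r\<close> strictly
  between the supremum over the frontier and \<open>u x\<close>.\<close>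

lemma Gamma_hull_of_levi_positive:
  fixes A :: "('m::{t2_space, second_countable_topology}, 'k::finite) chart set"
  assumes A: "complex_atlas A" and \<rho>: "Ck_manifold A 2 \<rho>"
    and dir: "\<And>z. \<exists>c\<in>charts_at A z. \<exists>\<xi>\<in>\<Gamma> z. 0 < levi_form c \<rho> (\<xi> c) z"
    and U: "open U" "compact (closure U)"
  shows "U \<subseteq> Gamma_hull A \<Gamma> (frontier U)"
proof
  fix x assume x: "x \<in> U"
  have "ereal (u x) \<le> (SUP y\<in>frontier U. ereal (u y))" if u: "u \<in> P_class A \<Gamma>" for u
  proof (rule ccontr)
    assume "\<not> ereal (u x) \<le> (SUP y\<in>frontier U. ereal (u y))"
    \<comment> \<open>A real \<open>r\<close> exists even for an empty frontier, where the supremum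
      is minus infinity.\<close>
    then have "(SUP y\<in>frontier U. ereal (u y)) < ereal (u x)" by (simp only: not_le)
    from ereal_dense2[OF this] obtain r
      where r: "(SUP y\<in>frontier U. ereal (u y)) < ereal r" "ereal r < ereal (u x)" by blast
    have psh: "0 \<le> pair11 (i_ddbar A (\<lambda>y. complex_of_real (u y))) c z \<xi>"
      if "\<xi> \<in> \<Gamma> z" "c \<in> charts_at A z" for z \<xi> c
      using u that by (auto simp: P_class_def)
    have C2: "Ck_manifold A 2 u" using u by (simp add: P_class_def)
    let ?\<phi> = "\<lambda>z. r + (-1) * u z"
    have "0 \<le> ?\<phi> x"
    proof (rule levi_minimum_principle[OF A \<rho> _ U _ _ x])
      show "Ck_manifold A 2 ?\<phi>" by (intro Ck_manifold_intros A C2)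
      show "0 \<le> ?\<phi> z" if "z \<in> frontier U" for z
      proof -
        have "ereal (u z) \<le> (SUP y\<in>frontier U. ereal (u y))" using that by (intro SUP_upper)
        then have "ereal (u z) < ereal r" using r(1) by (rule le_less_trans)
        then show ?thesis by simp
      qed
      fix z assume "z \<in> U"
      obtain c \<xi> where c: "c \<in> charts_at A z" "\<xi> \<in> \<Gamma> z" "0 < levi_form c \<rho> (\<xi> c) z" using dir by blast
      have c': "c \<in> A" "z \<in> fst c" using c(1) by (auto simp: charts_at_def)
      have "0 \<le> levi_form c u (\<xi> c) z"
        using psh[OF c(2,1)] unfolding pair11_def sesq_i_ddbar_real[OF A c(1) C2] by (simp add: less_eq_complex_def)
      then have "levi_form c ?\<phi> (\<xi> c) z \<le> 0"
        by (simp only: levi_form_add[OF A c' Ck_manifold_const Ck_manifold_scale[OF A C2]]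
            levi_form_scale[OF A c' C2] levi_form_const)
      then show "\<exists>c\<in>charts_at A z. \<exists>v. 0 < levi_form c \<rho> v z \<and> levi_form c ?\<phi> v z \<le> 0"
        using c by blast
    qed
    then show False using r(2) by simp
  qed
  then show "x \<in> Gamma_hull A \<Gamma> (frontier U)" by (simp add: Gamma_hull_def)
qed

text \<open>The current need not be directed by \<open>\<Gamma>\<close>, so a vector of positive Levi form for \<open>\<rho>\<close> can be
  kept constant in a chart; this makes the choice of directions locally finite.\<close>

lemma finite_positive_directions:
  fixes A :: "('m::{t2_space, second_countable_topology}, 'k::finite) chart set"
  assumes A: "complex_atlas A" and \<rho>: "Ck_manifold A 2 \<rho>"
    and dir: "\<And>z. \<exists>c\<in>charts_at A z. \<exists>v. 0 < levi_form c \<rho> v z"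
    and K: "compact K"
  obtains I :: "(('m, 'k) chart \<times> (complex ^ 'k) \<times> (complex ^ 'k) set) set" and \<delta>
  where "finite I" "\<delta> > 0"
    "\<And>c v B. (c, v, B) \<in> I \<Longrightarrow> c \<in> A \<and> compact B \<and> B \<subseteq> chart_image c"
    "\<And>c v B p. (c, v, B) \<in> I \<Longrightarrow> p \<in> B \<Longrightarrow> \<delta> \<le> levi_form c \<rho> v (chart_inv c p)"
    "\<And>y. y \<in> K \<Longrightarrow> \<exists>(c, v, B)\<in>I. y \<in> fst c \<and> snd c y \<in> B"
proof -
  have "\<exists>c v B W d. c \<in> A \<and> compact B \<and> B \<subseteq> chart_image c \<and> d > 0 \<and>
      (\<forall>p\<in>B. d \<le> levi_form c \<rho> v (chart_inv c p)) \<and> open W \<and> z \<in> W \<and> W \<subseteq> fst c \<and> snd c ` W \<subseteq> B" for z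
  proof -
    obtain c v where c: "c \<in> charts_at A z" "0 < levi_form c \<rho> v z" using dir by blast
    have c': "c \<in> A" "z \<in> fst c" using c(1) by (auto simp: charts_at_def)
    define d where "d = levi_form c \<rho> v z / 2"
    have "d > 0" using c(2) by (simp add: d_def)
    \<comment> \<open>The Levi form of \<open>\<rho>\<close> stays above half its value at
      \<open>z\<close> on the open set \<open>S\<close>. A closed ball in \<open>S\<close> will be
      the compact set \<open>B\<close>, and the preimage of the open ball the neighbourhood
      \<open>W\<close>.\<close>
    define S where "S = chart_image c \<inter> (\<lambda>p. levi_form c \<rho> v (chart_inv c p)) -` {d<..}"
    have "open S" unfolding S_def
      by (intro continuous_open_preimage[OF continuous_on_levi_form[OF A c'(1) \<rho>]] atlasD(2)[OF A c'(1)] open_greaterThan)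
    moreover have "snd c z \<in> S" using c(2) c' by (simp add: S_def d_def atlasD[OF A c'(1)])
    ultimately obtain r where r: "r > 0" "cball (snd c z) r \<subseteq> S" unfolding open_contains_cball by blast
    have "open {y \<in> fst c. snd c y \<in> ball (snd c z) r}"
      by (rule chart_preimage_open[OF A c'(1) open_ball])
    then show ?thesis
      using c' r \<open>d > 0\<close>
      by (intro exI[of _ c] exI[of _ v] exI[of _ "cball (snd c z) r"]
          exI[of _ "{y \<in> fst c. snd c y \<in> ball (snd c z) r}"] exI[of _ d])
        (auto simp: S_def subset_eq less_imp_le)
  qed
  then obtain c v B W d where cv: "\<And>z. c z \<in> A" "\<And>z. compact (B z)" "\<And>z. B z \<subseteq> chart_image (c z)"
    "\<And>z. d z > 0" "\<And>z p. p \<in> B z \<Longrightarrow> d z \<le> levi_form (c z) \<rho> (v z) (chart_inv (c z) p)"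
    "\<And>z. open (W z)" "\<And>z. z \<in> W z" "\<And>z. W z \<subseteq> fst (c z)" "\<And>z. snd (c z) ` W z \<subseteq> B z"
    by metis
  have "\<exists>Z\<subseteq>K. finite Z \<and> K \<subseteq> (\<Union>z\<in>Z. W z)"
  proof (rule compactE_image[OF K, where C = K and f = W])
    show "K \<subseteq> (\<Union>z\<in>K. W z)" using cv(7) by blast
  qed (use cv(6) in blast)+
  then obtain Z where Z: "finite Z" "K \<subseteq> (\<Union>z\<in>Z. W z)" by blast
  define \<delta> where "\<delta> = Min (insert 1 (d ` Z))"
  have \<delta>_le: "\<delta> \<le> d z" if "z \<in> Z" for z
    unfolding \<delta>_def by (rule Min_le) (simp_all add: Z that)
  show ?thesis
  proof (rule that[of "(\<lambda>z. (c z, v z, B z)) ` Z" \<delta>])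
    show "finite ((\<lambda>z. (c z, v z, B z)) ` Z)" using Z(1) by simp
    have "\<delta> \<in> insert 1 (d ` Z)" unfolding \<delta>_def by (rule Min_in) (simp_all add: Z)
    then show "\<delta> > 0" using cv(4) by auto
    show "c' \<in> A \<and> compact B' \<and> B' \<subseteq> chart_image c'" if "(c', v', B') \<in> (\<lambda>z. (c z, v z, B z)) ` Z" for c' v' B'
      using that cv(1-3) by auto
    show "\<delta> \<le> levi_form c' \<rho> v' (chart_inv c' p)"
      if mem: "(c', v', B') \<in> (\<lambda>z. (c z, v z, B z)) ` Z" and p: "p \<in> B'" for c' v' B' p
    proof -
      obtain z where "z \<in> Z" "c' = c z" "v' = v z" "B' = B z" using mem by blast
      then show ?thesis using \<delta>_le[of z] cv(5)[of p z] p by simp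
    qed
    show "\<exists>(c', v', B')\<in>(\<lambda>z. (c z, v z, B z)) ` Z. y \<in> fst c' \<and> snd c' y \<in> B'" if y: "y \<in> K" for y
    proof -
      obtain z where "z \<in> Z" "y \<in> W z" using Z(2) y by blast
      then show ?thesis using cv(8)[of z] cv(9)[of z] by (intro bexI[of _ "(c z, v z, B z)"]) auto
    qed
  qed
qed

lemma (in positive_functional) tendsto_zero:
  assumes "\<And>e. e > 0 \<Longrightarrow> \<forall>\<^sub>F n in F. \<forall>x\<in>X. \<bar>f n x\<bar> \<le> e"
  shows "((\<lambda>n. \<Lambda> (f n)) \<longlongrightarrow> 0) F"
proof (rule tendstoI)
  fix e :: real assume "e > 0"
  define M where "M = \<Lambda> (\<lambda>_. 1)"
  have M: "M \<ge> 0" unfolding M_def by (rule nonneg) auto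
  define e' where "e' = e / (M + 1)"
  have e': "e' > 0" using \<open>e > 0\<close> M by (simp add: e'_def)
  have "e' * M < e" using \<open>e > 0\<close> M by (simp add: e'_def field_simps)
  from assms[OF e'] show "\<forall>\<^sub>F n in F. dist (\<Lambda> (f n)) 0 < e"
  proof eventually_elim
    case (elim n)
    then have "\<bar>\<Lambda> (f n)\<bar> \<le> e' * M" unfolding M_def by (intro abs_le) auto
    then show ?case using \<open>e' * M < e\<close> by simp
  qed
qed

section \<open>The current of a selection of directions\<close>

text \<open>An average over \<open>U\<close>, with respect to \<open>\<Lambda>\<close>, of the
  pairing of \<open>\<omega>\<close> with the direction \<open>vv y\<close> read in the chart
  \<open>cc y\<close>. Real and imaginary parts are separated because \<open>\<Lambda>\<close> is
  real.\<close>

definition directed_current ::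
  "'m set \<Rightarrow> (('m \<Rightarrow> real) \<Rightarrow> real) \<Rightarrow> ('m \<Rightarrow> ('m, 'k::finite) chart) \<Rightarrow> ('m \<Rightarrow> complex ^ 'k)
    \<Rightarrow> ('m, 'k) form11 \<Rightarrow> complex" where
  "directed_current U \<Lambda> cc vv \<omega> =
     Complex (\<Lambda> (\<lambda>y. indicator U y * Re (sesq (\<omega> (cc y) y) (vv y) (vv y))))
             (\<Lambda> (\<lambda>y. indicator U y * Im (sesq (\<omega> (cc y) y) (vv y) (vv y))))"

text \<open>The selection \<open>cc\<close>, \<open>vv\<close> may be wild, but it takes values from
  a finite list of charts and vectors, each paired with a compact set \<open>B\<close> on which
  \<open>g c v\<close> is continuous. All values thus lie in a finite union of compact sets,
  together with 0.\<close>

lemma bdd_fun_indicator_locally_finite: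
  assumes I: "finite I" "\<And>c v B. (c, v, B) \<in> I \<Longrightarrow> compact B"
    and sel: "\<And>y. y \<in> U \<Longrightarrow> y \<in> fst (cc y) \<and> (\<exists>B. (cc y, vv y, B) \<in> I \<and> snd (cc y) y \<in> B)"
    and cont: "\<And>c v B. (c, v, B) \<in> I \<Longrightarrow> continuous_on B (g c v)"
    and f: "\<And>y. y \<in> U \<Longrightarrow> f y = (g (cc y) (vv y) (snd (cc y) y) :: real)"
  shows "(\<lambda>y. indicator U y * f y) \<in> bdd_fun X"
proof -
  have "bounded (insert 0 (\<Union>(c, v, B)\<in>I. g c v ` B))"
    using I cont by (auto intro!: bounded_UN compact_imp_bounded compact_continuous_image)
  moreover have "(\<lambda>y. indicator U y * f y) ` X \<subseteq> insert 0 (\<Union>(c, v, B)\<in>I. g c v ` B)"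
  proof
    fix r assume "r \<in> (\<lambda>y. indicator U y * f y) ` X"
    then obtain y where r: "r = indicator U y * f y" by blast
    show "r \<in> insert 0 (\<Union>(c, v, B)\<in>I. g c v ` B)"
    proof (cases "y \<in> U")
      case True
      then obtain B where "(cc y, vv y, B) \<in> I" "snd (cc y) y \<in> B" using sel by blast
      then show ?thesis using True f[OF True] r by force
    qed (simp add: r)
  qed
  ultimately show ?thesis unfolding bdd_fun_def by (blast intro: bounded_subset)
qed

locale locally_finite_directions = positive_functional X \<Lambda>
  for X :: "'m::{t2_space, second_countable_topology} set" and \<Lambda> +
  fixes A :: "('m, 'k::finite) chart set"
    and I :: "(('m, 'k) chart \<times> (complex ^ 'k) \<times> (complex ^ 'k) set) set"
    and U :: "'m set" and cc :: "'m \<Rightarrow> ('m, 'k) chart" and vv :: "'m \<Rightarrow> complex ^ 'k"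
  assumes A: "complex_atlas A"
    and I: "finite I" "\<And>c v B. (c, v, B) \<in> I \<Longrightarrow> c \<in> A \<and> compact B \<and> B \<subseteq> chart_image c"
    and sel: "\<And>y. y \<in> U \<Longrightarrow> y \<in> fst (cc y) \<and> (\<exists>B. (cc y, vv y, B) \<in> I \<and> snd (cc y) y \<in> B)"
begin

abbreviation "T \<equiv> directed_current U \<Lambda> cc vv"

abbreviation "dsesq \<omega> y \<equiv> sesq (\<omega> (cc y) y) (vv y) (vv y)"

lemma sel_chart: "y \<in> U \<Longrightarrow> cc y \<in> charts_at A y"
  using sel[of y] I(2)[of "cc y" "vv y"] by (auto simp: charts_at_def)

lemma inv_sel: "y \<in> U \<Longrightarrow> chart_inv (cc y) (snd (cc y) y) = y"
  using atlasD(5)[OF A, of "cc y" y] sel_chart[of y] by (simp add: charts_at_def)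

lemma bdd_fun_dsesq:
  assumes \<omega>: "\<omega> \<in> test_forms11 A"
  shows "(\<lambda>y. indicator U y * Re (dsesq \<omega> y)) \<in> bdd_fun X"
    and "(\<lambda>y. indicator U y * Im (dsesq \<omega> y)) \<in> bdd_fun X"
proof -
  have *: "continuous_on B (\<lambda>p. sesq (\<omega> c (chart_inv c p)) v v)" if "(c, v, B) \<in> I" for c v B
    using continuous_on_subset[OF continuous_on_sesq_test_form[OF \<omega>]] I(2)[OF that] by blast
  show "(\<lambda>y. indicator U y * Re (dsesq \<omega> y)) \<in> bdd_fun X"
    by (rule bdd_fun_indicator_locally_finite[OF I(1) _ sel, where g = "\<lambda>c v p. Re (sesq (\<omega> c (chart_inv c p)) v v)"])
       (use I(2) * in \<open>auto simp: inv_sel intro: continuous_on_Re\<close>)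
  show "(\<lambda>y. indicator U y * Im (dsesq \<omega> y)) \<in> bdd_fun X"
    by (rule bdd_fun_indicator_locally_finite[OF I(1) _ sel, where g = "\<lambda>c v p. Im (sesq (\<omega> c (chart_inv c p)) v v)"])
       (use I(2) * in \<open>auto simp: inv_sel intro: continuous_on_Im\<close>)
qed

text \<open>\<open>T\<close> is of order zero: the integrand is controlled by the sup norms of the
  coefficients on the finitely many compact sets \<open>B\<close>.\<close>

lemma dsesq_tendsto_0:
  assumes W: "test_forms_tendsto_0 A W" and "e > 0"
  shows "\<forall>\<^sub>F n in sequentially. \<forall>y\<in>U. norm (dsesq (W n) y) \<le> e"
proof -
  have ev: "\<forall>\<^sub>F n in sequentially. \<forall>p\<in>B. norm (sesq (W n c (chart_inv c p)) v v) \<le> e" if cvB: "(c, v, B) \<in> I" for c v B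
  proof -
    define s where "s = (\<Sum>j\<in>UNIV. \<Sum>l\<in>UNIV. norm (v $ j) * norm (v $ l))"
    have s: "s \<ge> 0" unfolding s_def by (intro sum_nonneg) simp
    define e' where "e' = e / (s + 1)"
    have e': "e' > 0" "e' * s \<le> e" using \<open>e > 0\<close> s by (auto simp: e'_def field_simps)
    have "uniform_limit B (\<lambda>n. iter_deriv [] (form_coeff (W n) c j l)) (\<lambda>_. 0) sequentially" for j l
      using W I(2)[OF cvB] unfolding test_forms_tendsto_0_def by blast
    then have "\<forall>\<^sub>F n in sequentially. \<forall>p\<in>B. dist (form_coeff (W n) c j l p) 0 < e'" for j l
      using e'(1) unfolding uniform_limit_iff by simp
    then have "\<forall>\<^sub>F n in sequentially. \<forall>j l. \<forall>p\<in>B. norm (form_coeff (W n) c j l p) < e'"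
      by (simp add: eventually_all_finite)
    then show ?thesis
    proof eventually_elim
      case (elim n)
      show ?case
      proof
        fix p assume "p \<in> B"
        then have "norm (sesq (W n c (chart_inv c p)) v v) \<le> e' * s"
          unfolding s_def using elim by (intro norm_sesq_le) (auto simp: form_coeff_def less_imp_le)
        then show "norm (sesq (W n c (chart_inv c p)) v v) \<le> e" using e'(2) by linarith
      qed
    qed
  qed
  have "\<forall>\<^sub>F n in sequentially. \<forall>i\<in>I. \<forall>p\<in>snd (snd i).
      norm (sesq (W n (fst i) (chart_inv (fst i) p)) (fst (snd i)) (fst (snd i))) \<le> e"
    using ev by (intro eventually_ball_finite I(1)) auto
  then show ?thesis
  proof eventually_elim
    case (elim n)
    show ?case
    proof
      fix y assume y: "y \<in> U"
      then obtain B where "(cc y, vv y, B) \<in> I" "snd (cc y) y \<in> B" using sel by blast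
      then show "norm (dsesq (W n) y) \<le> e" using elim y by (force simp: inv_sel)
    qed
  qed
qed

lemma current11_directed: "current11 A T"
  unfolding current11_def
proof (intro conjI ballI allI impI)
  fix \<omega> \<omega>' assume \<omega>: "\<omega> \<in> test_forms11 A" "\<omega>' \<in> test_forms11 A"
  show "T (\<lambda>c z. \<omega> c z + \<omega>' c z) = T \<omega> + T \<omega>'"
    using add[OF bdd_fun_dsesq(1)[OF \<omega>(1)] bdd_fun_dsesq(1)[OF \<omega>(2)]]
      add[OF bdd_fun_dsesq(2)[OF \<omega>(1)] bdd_fun_dsesq(2)[OF \<omega>(2)]]
    by (simp add: directed_current_def sesq_add complex_eq_iff distrib_left)
next
  fix \<omega> a assume \<omega>: "\<omega> \<in> test_forms11 A"
  note b = bdd_fun_dsesq[OF \<omega>]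
  have "\<Lambda> (\<lambda>y. indicator U y * (Re a * Re (dsesq \<omega> y) - Im a * Im (dsesq \<omega> y)))
      = Re a * Re (T \<omega>) - Im a * Im (T \<omega>)"
    using diff[OF bdd_fun_scale[OF b(1), of "Re a"] bdd_fun_scale[OF b(2), of "Im a"]]
    by (simp add: scale[OF b(1)] scale[OF b(2)] directed_current_def algebra_simps)
  moreover have "\<Lambda> (\<lambda>y. indicator U y * (Re a * Im (dsesq \<omega> y) + Im a * Re (dsesq \<omega> y)))
      = Re a * Im (T \<omega>) + Im a * Re (T \<omega>)"
    using add[OF bdd_fun_scale[OF b(2), of "Re a"] bdd_fun_scale[OF b(1), of "Im a"]]
    by (simp add: scale[OF b(1)] scale[OF b(2)] directed_current_def algebra_simps)
  ultimately show "T (\<lambda>c z. \<chi> j l. a * \<omega> c z $ j $ l) = a * T \<omega>"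
    unfolding complex_eq_iff times_complex.sel
    by (simp add: directed_current_def[of _ _ _ _ "\<lambda>c z. \<chi> j l. a * \<omega> c z $ j $ l"] sesq_scale)
next
  fix W assume W: "(\<forall>n. W n \<in> test_forms11 A) \<and> test_forms_tendsto_0 A W"
  have le: "\<bar>indicator U x * Re z\<bar> \<le> e" "\<bar>indicator U x * Im z\<bar> \<le> e"
    if "x \<in> U \<Longrightarrow> norm z \<le> e" "e > 0" for x :: 'm and z e
    using that abs_Re_le_cmod[of z] abs_Im_le_cmod[of z] by (cases "x \<in> U"; force)+
  have ev: "\<forall>\<^sub>F n in sequentially. \<forall>x\<in>X. \<bar>indicator U x * Re (dsesq (W n) x)\<bar> \<le> e"
    "\<forall>\<^sub>F n in sequentially. \<forall>x\<in>X. \<bar>indicator U x * Im (dsesq (W n) x)\<bar> \<le> e" if "e > 0" for e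
    using dsesq_tendsto_0[of W e] W that by (auto elim!: eventually_mono intro!: le)
  have "(\<lambda>n. Complex (\<Lambda> (\<lambda>y. indicator U y * Re (dsesq (W n) y)))
     (\<Lambda> (\<lambda>y. indicator U y * Im (dsesq (W n) y)))) \<longlonglongrightarrow> Complex 0 0"
    by (intro tendsto_Complex tendsto_zero ev)
  then show "(\<lambda>n. T (W n)) \<longlonglongrightarrow> 0"
    by (simp add: directed_current_def zero_complex.code)
qed

text \<open>A nonnegative complex number is real, so for a positive form the imaginary integrand
  vanishes identically and the real one is nonnegative.\<close>

lemma positive_current11_directed: "positive_current11 A T"
  unfolding positive_current11_def
proof (intro conjI ballI impI current11_directed)
  fix \<omega> assume \<omega>: "\<omega> \<in> test_forms11 A" and pos: "positive_form11 A \<omega>"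
  have "0 \<le> dsesq \<omega> y" if y: "y \<in> U" for y
  proof -
    note c = sel_chart[OF y]
    have "0 \<le> pair11 \<omega> (cc y) y (chart_vec A (cc y) y (vv y))"
      using pos chart_vec_tangent10(1)[OF A c] c by (simp add: positive_form11_def)
    then show ?thesis by (simp add: pair11_def chart_vec_tangent10(2)[OF A c])
  qed
  then have Re: "0 \<le> indicator U y * Re (dsesq \<omega> y)" and Im: "indicator U y * Im (dsesq \<omega> y) = 0" for y
    by (auto simp: less_eq_complex_def indicator_def)
  have "0 \<le> \<Lambda> (\<lambda>y. indicator U y * Re (dsesq \<omega> y))"
    by (rule nonneg[OF bdd_fun_dsesq(1)[OF \<omega>] Re])
  then show "0 \<le> T \<omega>" by (simp add: directed_current_def Im zero less_eq_complex_def)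
qed

lemma compact_support_directed:
  assumes "compact (closure U)"
  shows "compact (current_support A T)"
proof -
  have "T \<omega> = 0" if "form_support \<omega> \<subseteq> - closure U" for \<omega>
  proof -
    have "\<omega> c y = 0" if y: "y \<in> U" for c y
    proof (rule ccontr)
      assume "\<omega> c y \<noteq> 0"
      then have "y \<in> {z. \<exists>c. \<omega> c z \<noteq> 0}" by blast
      then have "y \<in> form_support \<omega>" unfolding form_support_def by (rule subsetD[OF closure_subset])
      then show False using y \<open>form_support \<omega> \<subseteq> - closure U\<close> closure_subset by blast
    qed
    then have "(\<lambda>y. indicator U y * Re (dsesq \<omega> y)) = (\<lambda>_. 0)" "(\<lambda>y. indicator U y * Im (dsesq \<omega> y)) = (\<lambda>_. 0)"
      by (auto simp: indicator_def sesq_def fun_eq_iff)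
    then show ?thesis unfolding directed_current_def by (simp only: zero zero_complex.code)
  qed
  then have "- closure U \<in> {V. open V \<and> (\<forall>\<omega>\<in>test_forms11 A. form_support \<omega> \<subseteq> V \<longrightarrow> T \<omega> = 0)}"
    by (simp add: open_Compl)
  then have "current_support A T \<subseteq> closure U"
    unfolding current_support_def by blast
  moreover have "closed (current_support A T)"
    unfolding current_support_def by (intro closed_Compl open_Union) auto
  ultimately show ?thesis using assms by (metis compact_Int_closed inf.absorb_iff2)
qed

end

lemma measure_and_current_of_levi_positive:
  fixes A :: "('m::{t2_space, second_countable_topology}, 'k::finite) chart set"
  assumes A: "complex_atlas A" and \<rho>: "Ck_manifold A 2 \<rho>"
    and dir: "\<And>z. \<exists>c\<in>charts_at A z. \<exists>v. 0 < levi_form c \<rho> v z"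
    and U: "open U" "compact (closure U)" and x: "x \<in> U"
  obtains \<mu> :: "'m measure" and T :: "('m, 'k) form11 \<Rightarrow> complex"
  where "prob_space \<mu>" "sets \<mu> = sets (restrict_space borel (frontier U))"
    "positive_current11 A T" "compact (current_support A T)"
    "\<And>\<phi>. \<phi> \<in> test_functions A \<Longrightarrow>
      i_ddbar_current A T \<phi> = (\<integral>y. \<phi> y \<partial>\<mu>) - (\<integral>y. \<phi> y \<partial>return borel x)"
proof -
  let ?X = "closure U" and ?K = "frontier U"
  obtain I :: "(('m, 'k) chart \<times> (complex ^ 'k) \<times> (complex ^ 'k) set) set" and \<delta>
    where I: "finite I" "\<delta> > 0"
      "\<And>c v B. (c, v, B) \<in> I \<Longrightarrow> c \<in> A \<and> compact B \<and> B \<subseteq> chart_image c"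
      "\<And>c v B p. (c, v, B) \<in> I \<Longrightarrow> p \<in> B \<Longrightarrow> \<delta> \<le> levi_form c \<rho> v (chart_inv c p)"
      "\<And>y. y \<in> ?X \<Longrightarrow> \<exists>(c, v, B)\<in>I. y \<in> fst c \<and> snd c y \<in> B"
    by (rule finite_positive_directions[OF A \<rho> dir U(2)]) (rule that)
  have "\<exists>c v B. (c, v, B) \<in> I \<and> y \<in> fst c \<and> snd c y \<in> B" if "y \<in> U" for y
    using I(5)[of y] that closure_subset[of U] by blast
  then obtain cc vv BB where sel: "\<And>y. y \<in> U \<Longrightarrow> (cc y, vv y, BB y) \<in> I"
    "\<And>y. y \<in> U \<Longrightarrow> y \<in> fst (cc y)" "\<And>y. y \<in> U \<Longrightarrow> snd (cc y) y \<in> BB y"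
    by metis
  have sel': "y \<in> fst (cc y) \<and> (\<exists>B. (cc y, vv y, B) \<in> I \<and> snd (cc y) y \<in> B)" if "y \<in> U" for y
    using sel[OF that] by blast
  have X: "y \<in> ?X \<longleftrightarrow> y \<in> U \<or> y \<in> ?K" and disj: "y \<in> U \<Longrightarrow> y \<notin> ?K" for y
    using U(1) closure_subset[of U] by (auto simp: frontier_def interior_open)
  have cA: "cc y \<in> A" if "y \<in> U" for y using I(3)[OF sel(1)[OF that]] by simp
  have cat: "cc y \<in> charts_at A y" if "y \<in> U" for y using cA sel(2) that by (simp add: charts_at_def)
  have cinv: "chart_inv (cc y) (snd (cc y) y) = y" if "y \<in> U" for y
    by (rule atlasD(5)[OF A cA[OF that] sel(2)[OF that]])
  have levi_\<rho>: "\<delta> \<le> levi_form (cc y) \<rho> (vv y) y" if "y \<in> U" for y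
    using I(4)[OF sel(1)[OF that] sel(3)[OF that]] cinv[OF that] by simp
  define L where "L \<phi> y = levi_form (cc y) \<phi> (vv y) y" for \<phi> y
  define J where "J \<phi> y = (if y \<in> U then - L \<phi> y else \<phi> y)" for \<phi> y
  have L_bdd: "(\<lambda>y. indicator U y * L \<phi> y) \<in> bdd_fun ?X" if \<phi>: "Ck_manifold A 2 \<phi>" for \<phi>
    unfolding L_def
  proof (rule bdd_fun_indicator_locally_finite[OF I(1) _ sel', where g = "\<lambda>c v p. levi_form c \<phi> v (chart_inv c p)"])
    show "continuous_on B (\<lambda>p. levi_form c \<phi> v (chart_inv c p))" if "(c, v, B) \<in> I" for c v B
      using continuous_on_subset[OF continuous_on_levi_form[OF A _ \<phi>]] I(3)[OF that] by blast
  qed (use I(3) cinv in auto)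
  have bdd: "\<phi> \<in> bdd_fun ?X" if \<phi>: "Ck_manifold A 2 \<phi>" for \<phi>
    using compact_imp_bounded[OF compact_continuous_image[OF Ck_manifold_continuous[OF A \<phi>] U(2)]]
    by (simp add: bdd_fun_def)
  have J_eq: "J \<phi> y = indicator ?K y * \<phi> y - indicator U y * L \<phi> y" if "y \<in> ?X" for \<phi> y
    using that X disj by (auto simp: J_def indicator_def)
  have J_bdd: "J \<phi> \<in> bdd_fun ?X" if \<phi>: "Ck_manifold A 2 \<phi>" for \<phi>
  proof -
    have "(\<lambda>y. indicator ?K y * \<phi> y - indicator U y * L \<phi> y) \<in> bdd_fun ?X"
      by (intro bdd_fun_diff bdd_fun_indicator bdd \<phi> L_bdd)
    then show ?thesis using J_eq by (simp add: bdd_fun_def cong: image_cong)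
  qed
  have J_add: "J (\<lambda>z. \<phi> z + \<psi> z) = (\<lambda>y. J \<phi> y + J \<psi> y)"
    if "Ck_manifold A 2 \<phi>" "Ck_manifold A 2 \<psi>" for \<phi> \<psi>
    using levi_form_add[OF A cA sel(2) that] by (auto simp: J_def L_def)
  have J_scale: "J (\<lambda>z. a * \<phi> z) = (\<lambda>y. a * J \<phi> y)" if "Ck_manifold A 2 \<phi>" for \<phi> a
    using levi_form_scale[OF A cA sel(2) that] by (auto simp: J_def L_def)
  \<comment> \<open>The graph of the assignment from the data \<open>J \<phi>\<close> to the value
    \<open>\<phi> x\<close>.\<close>
  define V where "V = {(J \<phi>, \<phi> x) |\<phi>. Ck_manifold A 2 \<phi>}"
  have VI: "(J \<phi>, \<phi> x) \<in> V" if "Ck_manifold A 2 \<phi>" for \<phi>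
    using that unfolding V_def by blast
  have VE: "\<exists>\<phi>. Ck_manifold A 2 \<phi> \<and> f = J \<phi> \<and> a = \<phi> x" if "(f, a) \<in> V" for f a
    using that unfolding V_def by blast
  obtain b where b: "\<And>y. y \<in> ?X \<Longrightarrow> \<bar>\<rho> y\<bar> \<le> b" using bdd[OF \<rho>] by (rule bdd_funE) blast
  \<comment> \<open>On the frontier, \<open>e = 1 + (b - \<rho>) / \<delta>\<close> is at least 1
    because \<open>\<rho> \<le> b\<close>; in \<open>U\<close> the data is
    \<open>L \<rho> / \<delta>\<close>, at least 1 by the choice of \<open>\<delta>\<close>.\<close>
  define e where "e y = (1 + b / \<delta>) + (- 1 / \<delta>) * \<rho> y" for y
  have e: "Ck_manifold A 2 e" unfolding e_def by (intro Ck_manifold_intros A \<rho>)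
  obtain \<Lambda> where \<Lambda>: "positive_functional ?X \<Lambda>" and \<Lambda>V: "\<And>f a. (f, a) \<in> V \<Longrightarrow> \<Lambda> f = a"
  proof (rule positive_extension[of V ?X "J e" "e x"])
    show "f \<in> bdd_fun ?X" if "(f, a) \<in> V" for f a using VE[OF that] J_bdd by blast
    show "(\<lambda>y. f y + g y, a + b) \<in> V" if fa: "(f, a) \<in> V" and gb: "(g, b) \<in> V" for f a g b
    proof -
      obtain \<phi> \<psi> where "Ck_manifold A 2 \<phi>" "f = J \<phi>" "a = \<phi> x" "Ck_manifold A 2 \<psi>" "g = J \<psi>" "b = \<psi> x"
        using VE[OF fa] VE[OF gb] by blast
      then show ?thesis using VI[OF Ck_manifold_add[OF A, of 2 \<phi> \<psi>]] J_add[of \<phi> \<psi>] by simp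
    qed
    show "(\<lambda>y. r * f y, r * a) \<in> V" if fa: "(f, a) \<in> V" for f a r
    proof -
      obtain \<phi> where "Ck_manifold A 2 \<phi>" "f = J \<phi>" "a = \<phi> x" using VE[OF fa] by blast
      then show ?thesis using VI[OF Ck_manifold_scale[OF A, of 2 \<phi> r]] J_scale[of \<phi> r] by simp
    qed
    show "(J e, e x) \<in> V" by (rule VI[OF e])
    show "1 \<le> J e y" if y: "y \<in> ?X" for y
    proof (cases "y \<in> U")
      case True
      have "L e y = 0 + (- 1 / \<delta>) * L \<rho> y"
        unfolding L_def e_def levi_form_add[OF A cA[OF True] sel(2)[OF True] Ck_manifold_const Ck_manifold_scale[OF A \<rho>]]
          levi_form_scale[OF A cA[OF True] sel(2)[OF True] \<rho>] levi_form_const ..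
      moreover have "1 \<le> L \<rho> y / \<delta>" using levi_\<rho>[OF True] I(2) by (simp add: L_def)
      ultimately show ?thesis using True by (simp add: J_def)
    next
      case False
      then show ?thesis using b[OF y] I(2) by (simp add: J_def e_def field_simps abs_le_iff)
    qed
    show "0 \<le> a" if fa: "(f, a) \<in> V" and f: "\<And>y. y \<in> ?X \<Longrightarrow> 0 \<le> f y" for f a
    proof -
      obtain \<phi> where \<phi>: "Ck_manifold A 2 \<phi>" "f = J \<phi>" "a = \<phi> x" using VE[OF fa] by blast
      have "0 \<le> \<phi> x"
      proof (rule levi_minimum_principle[OF A \<rho> \<phi>(1) U _ _ x])
        show "0 \<le> \<phi> z" if "z \<in> ?K" for z
        proof -
          have "z \<notin> U" "z \<in> ?X" using that disj X by blast+
          then show ?thesis using f[of z] by (simp add: \<phi>(2) J_def)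
        qed
        show "\<exists>c\<in>charts_at A z. \<exists>v. 0 < levi_form c \<rho> v z \<and> levi_form c \<phi> v z \<le> 0" if "z \<in> U" for z
        proof -
          have "z \<in> ?X" using that X by blast
          then have "levi_form (cc z) \<phi> (vv z) z \<le> 0" using f[of z] that by (simp add: \<phi>(2) J_def L_def)
          moreover have "0 < levi_form (cc z) \<rho> (vv z) z" using levi_\<rho>[OF that] I(2) by linarith
          ultimately show ?thesis using cat[OF that] by blast
        qed
      qed
      then show ?thesis by (simp add: \<phi>(3))
    qed
  qed blast
  interpret positive_functional ?X \<Lambda> by (rule \<Lambda>)
  interpret locally_finite_directions ?X \<Lambda> A I U cc vv
    by standard (fact A I(1,3) sel')+
  \<comment> \<open>The identity \<open>\<Lambda> (J \<phi>) = \<phi> x\<close> split into its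
    frontier and interior parts; this is already the equation for the current, up to replacing the
    frontier part by an integral.\<close>
  have rep: "\<Lambda> (\<lambda>y. indicator U y * L \<phi> y) = \<Lambda> (\<lambda>y. indicator ?K y * \<phi> y) - \<phi> x"
    if \<phi>: "Ck_manifold A 2 \<phi>" for \<phi>
  proof -
    have "\<phi> x = \<Lambda> (J \<phi>)" using \<Lambda>V[OF VI[OF \<phi>]] by simp
    also have "\<dots> = \<Lambda> (\<lambda>y. indicator ?K y * \<phi> y - indicator U y * L \<phi> y)"
      using J_eq by (intro cong J_bdd \<phi>) auto
    finally show ?thesis using diff[OF bdd_fun_indicator[OF bdd[OF \<phi>]] L_bdd[OF \<phi>], of ?K] by simp
  qed
  have ext: "(\<lambda>y. indicator ?K y * f y) \<in> bdd_fun ?X" if f: "f \<in> bdd_fun ?K" for f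
  proof -
    obtain b where "b > 0" "\<And>y. y \<in> ?K \<Longrightarrow> \<bar>f y\<bar> \<le> b" using f by (rule bdd_funE) blast
    then show ?thesis by (intro bdd_funI[of _ _ b]) (auto simp: indicator_def)
  qed
  have K: "compact ?K"
    using compact_Int_closed[OF U(2) frontier_closed[of U]] by (simp add: frontier_def Int_absorb1 Diff_subset)
  \<comment> \<open>Bounded functions on the frontier are extended by 0 to the closure of
    \<open>U\<close>.\<close>
  have posK: "positive_functional ?K (\<lambda>f. \<Lambda> (\<lambda>y. indicator ?K y * f y))"
  proof
    show "\<Lambda> (\<lambda>y. indicator ?K y * (f y + g y)) = \<Lambda> (\<lambda>y. indicator ?K y * f y) + \<Lambda> (\<lambda>y. indicator ?K y * g y)"
      if "f \<in> bdd_fun ?K" "g \<in> bdd_fun ?K" for f g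
      using add[OF ext[OF that(1)] ext[OF that(2)]] by (simp add: distrib_left)
    show "\<Lambda> (\<lambda>y. indicator ?K y * (a * f y)) = a * \<Lambda> (\<lambda>y. indicator ?K y * f y)" if "f \<in> bdd_fun ?K" for f a
      using scale[OF ext[OF that], of a] by (simp add: mult.left_commute)
    show "0 \<le> \<Lambda> (\<lambda>y. indicator ?K y * f y)" if "f \<in> bdd_fun ?K" "\<And>y. y \<in> ?K \<Longrightarrow> 0 \<le> f y" for f
      using that(2) by (intro nonneg ext that(1)) (auto simp: indicator_def)
  qed
  have one: "\<Lambda> (\<lambda>y. indicator ?K y * 1) = 1"
    using rep[OF Ck_manifold_const, of 1] by (simp add: L_def levi_form_const zero)
  obtain \<mu> where \<mu>: "prob_space \<mu>" "sets \<mu> = sets (restrict_space borel ?K)"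
    and \<mu>_int: "\<And>\<phi> :: 'm \<Rightarrow> real. continuous_on ?K \<phi> \<Longrightarrow> integral\<^sup>L \<mu> \<phi> = \<Lambda> (\<lambda>y. indicator ?K y * \<phi> y)"
    by (rule riesz_representation_compact[OF K posK one]) (rule that)
  interpret \<mu>: prob_space \<mu> by (rule \<mu>(1))
  have space_\<mu>: "space \<mu> = ?K" using sets_eq_imp_space_eq[OF \<mu>(2)] by (simp add: space_restrict_space)
  show ?thesis
  proof (rule that[of \<mu> T, OF \<mu> positive_current11_directed compact_support_directed[OF U(2)]])
    fix \<phi> assume "\<phi> \<in> test_functions A"
    then have \<phi>: "Ck_manifold A 2 \<phi>" by (simp add: test_functions_def smooth_manifold_def)
    note Re = Ck_manifold_bounded_linear[OF bounded_linear_Re A \<phi>]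
      and Im = Ck_manifold_bounded_linear[OF bounded_linear_Im A \<phi>]
    note cont = Ck_manifold_continuous[OF A \<phi>]
    have "\<phi> \<in> borel_measurable \<mu>"
      unfolding measurable_cong_sets[OF \<mu>(2) refl] by (rule borel_measurable_continuous_on_restrict[OF cont])
    moreover obtain M where "\<And>y. y \<in> ?K \<Longrightarrow> norm (\<phi> y) \<le> M"
      using compact_imp_bounded[OF compact_continuous_image[OF cont K]] unfolding bounded_iff by blast
    ultimately have int: "integrable \<mu> \<phi>"
      by (intro \<mu>.integrable_const_bound[where B = M]) (auto simp: space_\<mu>)
    have "dsesq (i_ddbar A \<phi>) y = Complex (L (\<lambda>z. Re (\<phi> z)) y) (L (\<lambda>z. Im (\<phi> z)) y)" if "y \<in> U" for y
      unfolding L_def by (rule sesq_i_ddbar[OF A cat[OF that] \<phi>])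
    then have LRe: "(\<lambda>y. indicator U y * Re (dsesq (i_ddbar A \<phi>) y)) = (\<lambda>y. indicator U y * L (\<lambda>z. Re (\<phi> z)) y)"
      and LIm: "(\<lambda>y. indicator U y * Im (dsesq (i_ddbar A \<phi>) y)) = (\<lambda>y. indicator U y * L (\<lambda>z. Im (\<phi> z)) y)"
      by (auto simp: indicator_def fun_eq_iff)
    have "i_ddbar_current A T \<phi> = Complex ((\<integral>y. Re (\<phi> y) \<partial>\<mu>) - Re (\<phi> x)) ((\<integral>y. Im (\<phi> y) \<partial>\<mu>) - Im (\<phi> x))"
      unfolding i_ddbar_current_def directed_current_def LRe LIm
      by (simp add: rep[OF Re] rep[OF Im] \<mu>_int Ck_manifold_continuous[OF A Re] Ck_manifold_continuous[OF A Im])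
    also have "\<dots> = (\<integral>y. \<phi> y \<partial>\<mu>) - \<phi> x"
      using int by (simp add: complex_eq_iff)
    also have "\<phi> x = (\<integral>y. \<phi> y \<partial>return borel x)"
      using cont by (subst integral_return) (auto intro: borel_measurable_continuous_onI)
    finally show "i_ddbar_current A T \<phi> = (\<integral>y. \<phi> y \<partial>\<mu>) - (\<integral>y. \<phi> y \<partial>return borel x)" .
  qed
qed

theorem theorem3p8:
  fixes A :: "('m::{t2_space, second_countable_topology}, 'k::finite) chart set"
    and \<Gamma> :: "'m \<Rightarrow> ('m, 'k) tvec set"
    and \<rho> :: "'m \<Rightarrow> real"
    and U :: "'m set"
  assumes "complex_atlas A"
    and "closed_family A \<Gamma>"
    and "\<And>z. closed_cone_at A z (\<Gamma> z)"
    and "\<And>z. \<Gamma> z \<noteq> {\<lambda>_. 0}"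
    and "smooth_exhaustion A \<rho>"
    and "\<And>z \<xi> c. \<xi> \<in> \<Gamma> z \<Longrightarrow> \<xi> \<noteq> (\<lambda>_. 0) \<Longrightarrow> c \<in> charts_at A z \<Longrightarrow>
           0 < pair11 (i_ddbar A (\<lambda>y. complex_of_real (\<rho> y))) c z \<xi>"
    and "open U" and "compact (closure U)"
  shows "U \<subseteq> Gamma_hull A \<Gamma> (frontier U) \<and>
    (\<forall>x\<in>U. \<exists>(\<mu> :: 'm measure) (T :: ('m, 'k) form11 \<Rightarrow> complex).
       prob_space \<mu> \<and> sets \<mu> = sets (restrict_space borel (frontier U)) \<and>
       positive_current11 A T \<and> compact (current_support A T) \<and>
       (\<forall>\<phi>\<in>test_functions A.
          i_ddbar_current A T \<phi> = (\<integral>y. \<phi> y \<partial>\<mu>) - (\<integral>y. \<phi> y \<partial>return borel x)))"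
proof -
  have \<rho>: "Ck_manifold A 2 \<rho>"
    using assms(5) by (simp add: smooth_exhaustion_def smooth_manifold_def)
  have dir: "\<exists>c\<in>charts_at A z. \<exists>\<xi>\<in>\<Gamma> z. 0 < levi_form c \<rho> (\<xi> c) z" for z
  proof -
    obtain c where c: "c \<in> charts_at A z" using charts_at_nonempty[OF assms(1)] .
    \<comment> \<open>\<open>closed_cone_at\<close> excludes the empty set, so a cone other than the
      zero cone contains a non-zero vector, and hypothesis 6 makes the Levi form of
      \<open>\<rho>\<close> positive on it.\<close>
    have "\<Gamma> z \<noteq> {}" using assms(3)[of z] by (simp add: closed_cone_at_def)
    then obtain \<xi> where \<xi>: "\<xi> \<in> \<Gamma> z" "\<xi> \<noteq> (\<lambda>_. 0)" using assms(4)[of z] by blast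
    have "0 < levi_form c \<rho> (\<xi> c) z"
      using assms(6)[OF \<xi> c] unfolding pair11_def sesq_i_ddbar_real[OF assms(1) c \<rho>] by (simp add: less_complex_def)
    then show ?thesis using c \<xi>(1) by blast
  qed
  have dir': "\<exists>c\<in>charts_at A z. \<exists>v. 0 < levi_form c \<rho> v z" for z using dir[of z] by blast
  show ?thesis
  proof (intro conjI ballI)
    show "U \<subseteq> Gamma_hull A \<Gamma> (frontier U)"
      by (rule Gamma_hull_of_levi_positive[OF assms(1) \<rho> dir assms(7,8)])
    fix x assume x: "x \<in> U"
    show "\<exists>(\<mu> :: 'm measure) (T :: ('m, 'k) form11 \<Rightarrow> complex).
       prob_space \<mu> \<and> sets \<mu> = sets (restrict_space borel (frontier U)) \<and>
       positive_current11 A T \<and> compact (current_support A T) \<and>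
       (\<forall>\<phi>\<in>test_functions A.
          i_ddbar_current A T \<phi> = (\<integral>y. \<phi> y \<partial>\<mu>) - (\<integral>y. \<phi> y \<partial>return borel x))"
      by (rule measure_and_current_of_levi_positive[OF assms(1) \<rho> dir' assms(7,8) x]) blast
  qed
qed

end
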